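(* Fix $i\in\{1,2\}$. Suppose $d=k$ and there exists a nonzero $b\in L^1((t_0,T);\mathbb R_+)$ such that $$|B(t,x)^\top y|\ge b(t)\,|y|\qquad\text{for a.e. }t\in(t_0,T),\ \forall(x,y)\in\mathbb R^d\times\mathbb R^d.$$ Then $\mathcal N_{\tau_i}(u)=\mathcal N_{\tau_i}(u,x^0)$ is uniformly coercive, viz. $$y^\top\mathcal N_{\tau_i}(u,x^0)\,y\ge\frac{e^{-2\Lambda_1\Delta t_0}\|b\|_1^2}{\Delta t_0}|y|^2\qquad\forall(y,x^0,u)\in\mathbb R^d\times\mathbb R^d\times L^\infty((t_0,T);\mathbb R^k).$$ Hence, one may take $C_i=\Delta t_0\,e^{2\Lambda_1\Delta t_0}\|b\|_1^{-2}$, so that $\mathcal F(C_i)=L^\infty((t_0,T);\mathbb R^k)$. In particular, $\mathcal S_i(\mathcal F(C_i))\subset\mathcal F(C_i)$.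
   Context: Setting. Fix $t_0<T$, $\Delta t_0:=T-t_0$; $|\cdot|$ is the Euclidean norm and $\|\cdot\|$ the spectral norm of matrices (operator norm for multilinear maps). $N_t:[t_0,T]\times\mathbb R^d\to\mathbb R^d$ satisfies: $t\mapsto N_t(x)$ is in $L^\infty(t_0,T)$ for each $x$; $x\mapsto N_t(x)$ is $C^2$ for each $t$; there are $\Lambda_1,\Lambda_2>0$ with $\|DN_t(x)\|\le\Lambda_1$ and $\|D^2N_t(x)\|\le\Lambda_2$ for all $(t,x)$. $\Phi_{s,t}$, $(s,t)\in[t_0,T]^2$, is the flow: $\frac{d}{dt}\Phi_{s,t}(x)=N_t(\Phi_{s,t}(x))$, $\Phi_{s,s}(x)=x$; $D\Phi_{s,t}$ is its derivative in $x$. $B\in L^\infty((t_0,T)\times\mathbb R^d;\mathbb R^{d\times k})$, $x\mapsto B(t,x)$ is $C^1$ with $\|D_xB(t,x)\|\le L_B$ for all $(t,x)$, for some $L_B\ge0$. For $x^0\in\mathbb R^d$ and $u\in L^\infty((t_0,T);\mathbb R^k)$, $x_u=x_{u,x^0}$ is the absolutely continuous solution of $\dot x(t)=N_t(x(t))+B(t,x(t))u(t)$, $x(t_0)=x^0$. Set $\tau_1:=t_0$, $\tau_2:=T$, and $$\mathcal N_{\tau_i}(u)=\mathcal N_{\tau_i}(u,x^0)=\int_{t_0}^TD\Phi_{t,\tau_i}(x_u(t))B(t,x_u(t))B(t,x_u(t))^\top D\Phi_{t,\tau_i}(x_u(t))^\top dt.$$ $\mathcal F(C_i):=\{u\in L^\infty((t_0,T);\mathbb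 R^k):\lambda_{\min}(\mathcal N_{\tau_i}(u))\ge C_i^{-1}\}$, with $\lambda_{\min}$ the smallest eigenvalue. For $y_i\in\mathbb R^d$, the synthesis map $\mathcal S_i:L^\infty((t_0,T);\mathbb R^k)\to L^\infty((t_0,T);\mathbb R^k)$ is $\mathcal S_i(u)(t)=B(t,x_u(t))^\top D\Phi_{t,\tau_i}(x_u(t))^\top\mathcal N_{\tau_i}(u)^\dagger y_i$ ($\dagger$: Moore–Penrose pseudoinverse). *)

theory Defs
  imports "HOL-Analysis.Analysis"
begin

section \<open>Function spaces\<close>

abbreviation time_measure :: "real \<Rightarrow> real \<Rightarrow> real measure" where
  "time_measure t0 T \<equiv> lebesgue_on {t0<..<T}"

text \<open>Elements of \<open>L\<^sup>\<infinity>\<close> and \<open>L\<^sup>1\<close> are represented by functions; everything below depends on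
  such a function only through its values almost everywhere.\<close>

definition Linfty :: "'a measure \<Rightarrow> ('a \<Rightarrow> 'b::real_normed_vector) set" where
  "Linfty M = {f \<in> borel_measurable M. \<exists>C. AE z in M. norm (f z) \<le> C}"

definition L1_norm :: "'a measure \<Rightarrow> ('a \<Rightarrow> real) \<Rightarrow> real" where
  "L1_norm M f = (\<integral>z. \<bar>f z\<bar> \<partial>M)"

section \<open>Matrices\<close>

definition spectral_norm :: "real^'n^'m \<Rightarrow> real" where
  "spectral_norm A = onorm ((*v) A)"

definition lambda_min :: "real^'n^'n \<Rightarrow> real" where
  "lambda_min A = Min {l. \<exists>v. v \<noteq> 0 \<and> A *v v = l *\<^sub>R v}"

definition mp_inverse :: "real^'n^'m \<Rightarrow> real^'m^'n" where
  "mp_inverse A = (THE X. A ** X ** A = A \<and> X ** A ** X = X \<and>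
     transpose (A ** X) = A ** X \<and> transpose (X ** A) = X ** A)"

section \<open>Absolutely continuous solutions of differential equations\<close>

text \<open>The usual \<open>\<epsilon>\<close>-\<open>\<delta>\<close> definition on \<open>[a,b]\<close>; a division is a finite family of
  non-overlapping compact intervals, here of total length less than \<open>\<delta>\<close>.\<close>

definition abs_continuous_on :: "real \<Rightarrow> real \<Rightarrow> (real \<Rightarrow> 'a::real_normed_vector) \<Rightarrow> bool" where
  "abs_continuous_on a b x \<longleftrightarrow>
     (\<forall>\<epsilon>>0. \<exists>\<delta>>0. \<forall>S D. D division_of S \<and> S \<subseteq> {a..b} \<and> (\<Sum>K\<in>D. Sup K - Inf K) < \<delta> \<longrightarrow>
        (\<Sum>K\<in>D. norm (x (Sup K) - x (Inf K))) < \<epsilon>)"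

text \<open>Vector fields are only measurable in time, so the equation is required at almost every
  time. The initial time \<open>s\<close> may be any point of \<open>[a,b]\<close>, as flows run in both directions.\<close>

definition is_ode_solution ::
  "real \<Rightarrow> real \<Rightarrow> (real \<Rightarrow> 'a \<Rightarrow> 'a::real_normed_vector) \<Rightarrow> real \<Rightarrow> 'a \<Rightarrow> (real \<Rightarrow> 'a) \<Rightarrow> bool" where
  "is_ode_solution a b f s p x \<longleftrightarrow>
     abs_continuous_on a b x \<and> x s = p \<and>
     (AE t in time_measure a b. (x has_vector_derivative f t (x t)) (at t))"

text \<open>Under the standing assumptions below the solution exists and is unique on \<open>[a,b]\<close>, so its
  values there do not depend on the choice; values outside \<open>[a,b]\<close> are never used.\<close>

definition ode_solution ::
  "real \<Rightarrow> real \<Rightarrow> (real \<Rightarrow> 'a \<Rightarrow> 'a::real_normed_vector) \<Rightarrow> real \<Rightarrow> 'a \<Rightarrow> real \<Rightarrow> 'a" where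
  "ode_solution a b f s p = (SOME x. is_ode_solution a b f s p x)"

section \<open>The control system\<close>

text \<open>The norms of \<open>DN t x\<close> and \<open>D2N t x\<close> are operator norms.\<close>

definition admissible_drift ::
  "real \<Rightarrow> real \<Rightarrow> (real \<Rightarrow> real^'d \<Rightarrow> real^'d) \<Rightarrow> real \<Rightarrow> real \<Rightarrow> bool" where
  "admissible_drift t0 T N \<Lambda>1 \<Lambda>2 \<longleftrightarrow>
     (\<forall>x. (\<lambda>t. N t x) \<in> Linfty (time_measure t0 T)) \<and>
     (\<exists>(DN :: real \<Rightarrow> real^'d \<Rightarrow> ((real^'d) \<Rightarrow>\<^sub>L (real^'d)))
       (D2N :: real \<Rightarrow> real^'d \<Rightarrow> ((real^'d) \<Rightarrow>\<^sub>L ((real^'d) \<Rightarrow>\<^sub>L (real^'d)))).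
       \<forall>t\<in>{t0..T}. continuous_on UNIV (D2N t) \<and>
         (\<forall>x. (N t has_derivative blinfun_apply (DN t x)) (at x) \<and>
              (DN t has_derivative blinfun_apply (D2N t x)) (at x) \<and>
              norm (DN t x) \<le> \<Lambda>1 \<and> norm (D2N t x) \<le> \<Lambda>2))"

text \<open>The library norm on matrices is the Frobenius norm; it enters only the qualitative
  conditions (essential boundedness, continuity), while the quantitative bound on the derivative
  uses the spectral norm.\<close>

definition admissible_control_operator ::
  "real \<Rightarrow> real \<Rightarrow> (real \<Rightarrow> real^'d \<Rightarrow> real^'k^'d) \<Rightarrow> real \<Rightarrow> bool" where
  "admissible_control_operator t0 T B LB \<longleftrightarrow>
     (\<lambda>(t, x). B t x) \<in> Linfty (lebesgue_on ({t0<..<T} \<times> UNIV)) \<and>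
     (\<exists>(DB :: real \<Rightarrow> real^'d \<Rightarrow> ((real^'d) \<Rightarrow>\<^sub>L (real^'k^'d))).
       \<forall>t\<in>{t0<..<T}. continuous_on UNIV (DB t) \<and>
         (\<forall>x. (B t has_derivative blinfun_apply (DB t x)) (at x) \<and>
              (\<forall>v. spectral_norm (blinfun_apply (DB t x) v) \<le> LB * norm v)))"

text \<open>\<open>flow t0 T N s t\<close> is \<open>\<Phi>\<^bsub>s,t\<^esub>\<close>: initial time \<open>s\<close>, final time \<open>t\<close>.\<close>

definition flow ::
  "real \<Rightarrow> real \<Rightarrow> (real \<Rightarrow> real^'d \<Rightarrow> real^'d) \<Rightarrow> real \<Rightarrow> real \<Rightarrow> real^'d \<Rightarrow> real^'d" where
  "flow t0 T N s t x = ode_solution t0 T N s x t"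

definition D_flow ::
  "real \<Rightarrow> real \<Rightarrow> (real \<Rightarrow> real^'d \<Rightarrow> real^'d) \<Rightarrow> real \<Rightarrow> real \<Rightarrow> real^'d \<Rightarrow> real^'d^'d" where
  "D_flow t0 T N s t x = jacobian (flow t0 T N s t) (at x)"

definition trajectory ::
  "real \<Rightarrow> real \<Rightarrow> (real \<Rightarrow> real^'d \<Rightarrow> real^'d) \<Rightarrow> (real \<Rightarrow> real^'d \<Rightarrow> real^'k^'d) \<Rightarrow>
   real^'d \<Rightarrow> (real \<Rightarrow> real^'k) \<Rightarrow> real \<Rightarrow> real^'d" where
  "trajectory t0 T N B x0 u = ode_solution t0 T (\<lambda>t x. N t x + B t x *v u t) t0 x0"

definition tau :: "real \<Rightarrow> real \<Rightarrow> nat \<Rightarrow> real" where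
  "tau t0 T i = (if i = 1 then t0 else T)"

definition gramian ::
  "real \<Rightarrow> real \<Rightarrow> (real \<Rightarrow> real^'d \<Rightarrow> real^'d) \<Rightarrow> (real \<Rightarrow> real^'d \<Rightarrow> real^'k^'d) \<Rightarrow>
   real \<Rightarrow> real^'d \<Rightarrow> (real \<Rightarrow> real^'k) \<Rightarrow> real^'d^'d" where
  "gramian t0 T N B \<tau> x0 u =
     (\<integral>t. (let x = trajectory t0 T N B x0 u t; M = D_flow t0 T N t \<tau> x in
            M ** B t x ** transpose (B t x) ** transpose M) \<partial>time_measure t0 T)"

definition coercive_controls ::
  "real \<Rightarrow> real \<Rightarrow> (real \<Rightarrow> real^'d \<Rightarrow> real^'d) \<Rightarrow> (real \<Rightarrow> real^'d \<Rightarrow> real^'k^'d) \<Rightarrow>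
   real \<Rightarrow> real^'d \<Rightarrow> real \<Rightarrow> (real \<Rightarrow> real^'k) set" where
  "coercive_controls t0 T N B \<tau> x0 C =
     {u \<in> Linfty (time_measure t0 T). lambda_min (gramian t0 T N B \<tau> x0 u) \<ge> inverse C}"

definition synthesis ::
  "real \<Rightarrow> real \<Rightarrow> (real \<Rightarrow> real^'d \<Rightarrow> real^'d) \<Rightarrow> (real \<Rightarrow> real^'d \<Rightarrow> real^'k^'d) \<Rightarrow>
   real \<Rightarrow> real^'d \<Rightarrow> real^'d \<Rightarrow> (real \<Rightarrow> real^'k) \<Rightarrow> real \<Rightarrow> real^'k" where
  "synthesis t0 T N B \<tau> x0 y u t =
     (let x = trajectory t0 T N B x0 u t in
       transpose (B t x) *v (transpose (D_flow t0 T N t \<tau> x) *v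
         (mp_inverse (gramian t0 T N B \<tau> x0 u) *v y)))"

end

theory Submission
  imports Defs
begin

text \<open>
  For \<open>W t = D\<Phi>\<^bsub>t,\<tau>\<^esub>(x(t)) B(t, x(t))\<close>, the Gramian is the integral of \<open>W W\<^sup>T\<close>, so its quadratic
  form at \<open>y\<close> is the integral of \<open>\<bar>W\<^sup>T y\<bar>\<^sup>2\<close>. Two solutions of \<open>x' = N\<^sub>t(x)\<close> can neither separate
  nor approach each other faster than at the exponential rate \<open>\<Lambda>1\<close>. Hence difference quotients
  of the flow, and with them \<open>\<bar>D\<Phi> h\<bar>\<close>, are at least \<open>exp (- \<Lambda>1 * (T - t0)) * \<bar>h\<bar>\<close>; as \<open>D\<Phi>\<close> is
  square, its transpose obeys the same lower bound. Together with \<open>\<bar>B\<^sup>T y\<bar> \<ge> b \<bar>y\<bar>\<close> this gives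
  \<open>\<bar>W\<^sup>T y\<bar> \<ge> exp (- \<Lambda>1 * (T - t0)) * b * \<bar>y\<bar>\<close>, and the Cauchy-Schwarz inequality in time turns the
  integral of the square into the square of the \<open>L\<^sup>1\<close> norm of \<open>b\<close> divided by \<open>T - t0\<close>
  (\<open>gram_coercive\<close>, \<open>gramian_coercive\<close>). The smallest eigenvalue of a symmetric matrix inherits a
  lower bound on the quadratic form (\<open>lambda_min_ge\<close>), so every essentially bounded control lies in
  the coercive class, and the synthesis map preserves that class as soon as it maps into
  \<open>L\<^sup>\<infinity>\<close>.

  This argument presupposes that the objects exist and that the integrand is measurable and
  bounded, which is where most of the work lies. Absolutely continuous solutions with an equation
  at almost every time are the same as continuous solutions of the integral equation
  (\<open>is_ode_solution_iff\<close>): in one direction by the fundamental theorem of calculus for absolutely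
  continuous functions, in the other by Lebesgue's differentiation theorem on the line. The integral
  equation is solved by a contraction in an exponentially weighted sup norm (\<open>solution_exists\<close>).
  Gronwall's inequality yields uniqueness and both exponential bounds, and, applied to the linearised
  equation, differentiability of the flow (\<open>flow_differentiable\<close>): the bound on the second derivative
  of \<open>N\<^sub>t\<close> makes the error of linearisation quadratic. The derivative of the flow is measurable along
  a curve because it is the pointwise limit of difference quotients that are continuous in time
  (\<open>measurable_D_flow\<close>).
\<close>

section \<open>Absolutely continuous functions and indefinite integrals\<close>

lemma abs_continuous_on_subset:
  assumes "abs_continuous_on a b x" "{r..t} \<subseteq> {a..b}"
  shows "abs_continuous_on r t x"
  using assms unfolding abs_continuous_on_def by (meson order_trans)

text \<open>
  This turns a sum over tagged intervals into one over an honest division, to which the definition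
  of absolute continuity applies. Dropping degenerate intervals loses nothing, as \<open>d\<close> vanishes there.
\<close>

lemma sum_tagged_intervals_eq_division:
  fixes p :: "(real \<times> real set) set"
  assumes p: "p tagged_partial_division_of S"
    and d: "\<And>u. d {u..u} = 0"
  shows "(\<Sum>(t,K)\<in>p. d K :: real) = sum d {K\<in>snd ` p. measure lborel K \<noteq> 0}"
proof -
  have p': "p tagged_division_of \<Union>(snd ` p)"
    using p tagged_partial_division_of_Union_self by blast
  define d' where "d' K = (if measure lborel K = 0 then 0 else d K)" for K
  have "d K = d' K" if tK: "(t,K) \<in> p" for t K
  proof -
    obtain u v where "K = {u..v}" "t \<in> K"
      using tagged_partial_division_ofD(2,4)[OF p tK] by auto
    then show ?thesis
      using d by (cases "u = v") (auto simp: d'_def)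
  qed
  then have "(\<Sum>(t,K)\<in>p. d K) = (\<Sum>(t,K)\<in>p. d' K)"
    by (intro sum.cong) auto
  also have "\<dots> = sum d' (snd ` p)"
    using p' by (rule sum.over_tagged_division_lemma) (auto simp: d'_def content_eq_0_interior)
  also have "\<dots> = sum d {K\<in>snd ` p. measure lborel K \<noteq> 0}"
    unfolding d'_def using p
    by (intro sum.mono_neutral_cong_right) (auto simp: tagged_partial_division_of_def)
  finally show ?thesis .
qed

text \<open>
  The fundamental theorem of calculus for absolutely continuous functions. The gauge integral makes
  the proof direct: an interval tagged outside the null set \<open>E\<close> is controlled by the derivative at its
  tag, and the gauge confines the intervals tagged in \<open>E\<close> to an open set of small measure, where
  absolute continuity bounds the total increment.
\<close>

lemma abs_continuous_on_has_integral:
  fixes x :: "real \<Rightarrow> 'a::banach"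
  assumes "a \<le> b" and ac: "abs_continuous_on a b x" and "negligible E"
    and der: "\<And>t. t \<in> {a..b} - E \<Longrightarrow> (x has_vector_derivative f t) (at t within {a..b})"
  shows "(f has_integral (x b - x a)) {a..b}"
proof -
  define g where "g t = (if t \<in> E then 0 else f t)" for t
  have "(g has_integral (x b - x a)) {a..b}"
    unfolding has_integral_real
  proof (intro allI impI)
    fix e :: real assume "e > 0"
    obtain \<delta> where "\<delta> > 0" and \<delta>: "\<And>S D. D division_of S \<Longrightarrow> S \<subseteq> {a..b} \<Longrightarrow>
        (\<Sum>K\<in>D. Sup K - Inf K) < \<delta> \<Longrightarrow> (\<Sum>K\<in>D. norm (x (Sup K) - x (Inf K))) < e/2"
      using ac \<open>e > 0\<close> unfolding abs_continuous_on_def by (meson half_gt_zero)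
    have E: "E \<in> sets lebesgue" "emeasure lebesgue E = 0"
      using \<open>negligible E\<close> by (auto simp: negligible_iff_null_sets null_sets_def)
    obtain U where U: "open U" "E \<subseteq> U" "U - E \<in> lmeasurable" "emeasure lebesgue (U - E) < ennreal \<delta>"
      using sets_lebesgue_outer_open[OF E(1) \<open>\<delta> > 0\<close>] by blast
    have Um: "U \<in> lmeasurable" "measure lebesgue U < \<delta>"
    proof -
      have U_eq: "U = (U - E) \<union> E" using U by auto
      then have em: "emeasure lebesgue U = emeasure lebesgue (U - E)"
        using E U by (metis emeasure_Un_null_set fmeasurableD null_setsI)
      then show "U \<in> lmeasurable"
        using U by (auto simp: fmeasurable_def)
      then show "measure lebesgue U < \<delta>"
        using em U \<open>\<delta> > 0\<close> by (metis emeasure_eq_measure2 ennreal_less_iff measure_nonneg)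
    qed
    define \<epsilon> where "\<epsilon> = e / (2 * (b - a + 1))"
    have "\<epsilon> > 0" using \<open>e > 0\<close> \<open>a \<le> b\<close> by (auto simp: \<epsilon>_def)
    have "\<exists>d>0. \<forall>y\<in>{a..b}. norm (y - t) < d \<longrightarrow> norm (x y - x t - (y - t) *\<^sub>R f t) \<le> \<epsilon> * norm (y - t)"
      if "t \<in> {a..b} - E" for t
      using der[OF that] \<open>\<epsilon> > 0\<close> unfolding has_vector_derivative_def has_derivative_within_alt by blast
    then obtain d where d: "\<And>t. t \<in> {a..b} - E \<Longrightarrow> d t > 0"
      "\<And>t y. t \<in> {a..b} - E \<Longrightarrow> y \<in> {a..b} \<Longrightarrow> norm (y - t) < d t \<Longrightarrow>
         norm (x y - x t - (y - t) *\<^sub>R f t) \<le> \<epsilon> * norm (y - t)"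
      by metis
    define \<gamma> where "\<gamma> t = (if t \<in> E then U else if t \<in> {a..b} then ball t (d t) else UNIV)" for t
    have "gauge \<gamma>"
      using U d(1) by (auto simp: \<gamma>_def gauge_def)
    moreover have "norm ((\<Sum>(t,K)\<in>p. measure lborel K *\<^sub>R g t) - (x b - x a)) < e"
      if p: "p tagged_division_of {a..b}" and fine: "\<gamma> fine p" for p
    proof -
      let ?x = "\<lambda>K. x (Sup K) - x (Inf K)"
      have fin: "finite p" using p by blast
      have K: "\<exists>u v. K = {u..v} \<and> u \<le> t \<and> t \<le> v \<and> a \<le> u \<and> v \<le> b \<and> K \<subseteq> \<gamma> t" if tK: "(t,K) \<in> p" for t K
      proof -
        have "t \<in> K" "K \<subseteq> {a..b}" "K \<subseteq> \<gamma> t"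
          using tagged_division_ofD(2,3)[OF p tK] fine tK by (auto simp: fine_def)
        moreover obtain u v where "K = cbox u v"
          using tagged_division_ofD(4)[OF p tK] by auto
        ultimately show ?thesis
          by (intro exI[of _ u] exI[of _ v]) auto
      qed
      define q where "q = {(t,K)\<in>p. t \<in> E}"
      have "q \<subseteq> p" by (auto simp: q_def)
      then have q: "q tagged_partial_division_of {a..b}"
        using p tagged_partial_division_subset by (auto simp: tagged_division_of_def)
      define D where "D = {K \<in> snd ` q. measure lborel K \<noteq> 0}"
      have D: "D division_of \<Union>D"
      proof (rule division_of_subset)
        show "snd ` q division_of \<Union>(snd ` q)"
          using q by (rule partial_division_of_tagged_division)
      qed (auto simp: D_def)
      have DU: "\<Union>D \<subseteq> U" "\<Union>D \<subseteq> {a..b}"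
        using K by (fastforce simp: D_def q_def \<gamma>_def)+
      have D_content: "Sup K - Inf K = measure lebesgue K" if "K \<in> D" for K
        using that K by (fastforce simp: D_def q_def)
      have "(\<Sum>K\<in>D. Sup K - Inf K) = sum (measure lebesgue) D"
        using D_content by simp
      also have "\<dots> = measure lebesgue (\<Union>D)"
        using D by (simp add: content_division)
      also have "\<dots> \<le> measure lebesgue U"
        using DU Um D by (intro measure_mono_fmeasurable) (auto intro: lmeasurable_division fmeasurableD)
      finally have "(\<Sum>K\<in>D. norm (?x K)) < e/2"
        using D DU Um by (intro \<delta>[of D "\<Union>D"]) auto
      then have bad: "(\<Sum>(t,K)\<in>q. norm (?x K)) < e/2"
        unfolding D_def using q by (subst sum_tagged_intervals_eq_division) auto
      have good: "norm (measure lborel K *\<^sub>R g t - ?x K) \<le> \<epsilon> * measure lborel K" if tK: "(t,K) \<in> p - q" for t K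
      proof -
        obtain u v where uv: "K = {u..v}" "u \<le> t" "t \<le> v" "a \<le> u" "v \<le> b" "K \<subseteq> \<gamma> t"
          using K tK by blast
        have t: "t \<in> {a..b} - E" "t \<notin> E" using tK uv by (auto simp: q_def)
        then have "{u..v} \<subseteq> ball t (d t)" using uv by (auto simp: \<gamma>_def)
        then have "u \<in> ball t (d t)" "v \<in> ball t (d t)" using uv(2,3) by (auto simp del: mem_ball)
        then have nu: "norm (u - t) < d t" "norm (v - t) < d t"
          by (auto simp: dist_norm abs_minus_commute)
        have "norm (measure lborel K *\<^sub>R g t - ?x K)
            = norm ((x u - x t - (u - t) *\<^sub>R f t) - (x v - x t - (v - t) *\<^sub>R f t))"
          using uv t by (simp add: g_def algebra_simps)
        also have "\<dots> \<le> \<epsilon> * norm (u - t) + \<epsilon> * norm (v - t)"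
          by (intro order_trans[OF norm_triangle_ineq4] add_mono d(2)[OF t(1)] nu) (use uv in auto)
        also have "\<dots> = \<epsilon> * measure lborel K" using uv by (simp add: algebra_simps)
        finally show ?thesis .
      qed
      have "norm ((\<Sum>(t,K)\<in>p. measure lborel K *\<^sub>R g t) - (x b - x a))
          = norm (\<Sum>(t,K)\<in>p. measure lborel K *\<^sub>R g t - ?x K)"
        using additive_tagged_division_1[OF \<open>a \<le> b\<close> p, of x]
        by (simp add: sum_subtractf case_prod_beta)
      also have "\<dots> \<le> (\<Sum>(t,K)\<in>p. norm (measure lborel K *\<^sub>R g t - ?x K))"
        by (rule order_trans[OF norm_sum]) (auto simp: case_prod_beta)
      also have "\<dots> = (\<Sum>(t,K)\<in>p - q. norm (measure lborel K *\<^sub>R g t - ?x K)) +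
                      (\<Sum>(t,K)\<in>q. norm (measure lborel K *\<^sub>R g t - ?x K))"
        using fin \<open>q \<subseteq> p\<close> by (rule sum.subset_diff[rotated])
      also have "(\<Sum>(t,K)\<in>q. norm (measure lborel K *\<^sub>R g t - ?x K)) = (\<Sum>(t,K)\<in>q. norm (?x K))"
        by (intro sum.cong) (auto simp: q_def g_def norm_minus_commute)
      also have "(\<Sum>(t,K)\<in>p - q. norm (measure lborel K *\<^sub>R g t - ?x K)) \<le> (\<Sum>(t,K)\<in>p - q. \<epsilon> * measure lborel K)"
        using good by (intro sum_mono) auto
      also have "\<dots> \<le> (\<Sum>(t,K)\<in>p. \<epsilon> * measure lborel K)"
        using fin \<open>\<epsilon> > 0\<close> by (intro sum_mono2) auto
      also have "\<dots> = \<epsilon> * (b - a)"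
      proof -
        have "(\<Sum>(t,K)\<in>p. measure lborel K) = b - a"
          using additive_content_tagged_division[of p a b, unfolded box_real, OF p] \<open>a \<le> b\<close> by simp
        then show ?thesis
          unfolding case_prod_beta sum_distrib_left[symmetric] by simp
      qed
      also have "\<dots> \<le> e/2"
        using \<open>e > 0\<close> \<open>a \<le> b\<close> by (simp add: \<epsilon>_def field_simps)
      finally show ?thesis using bad by simp
    qed
    ultimately show "\<exists>\<gamma>. gauge \<gamma> \<and> (\<forall>p. p tagged_division_of {a..b} \<and> \<gamma> fine p \<longrightarrow>
        norm ((\<Sum>(t,K)\<in>p. measure lborel K *\<^sub>R g t) - (x b - x a)) < e)"
      by (intro exI[of _ \<gamma>] conjI allI impI) (simp_all only:)
  qed
  then show ?thesis
    by (rule has_integral_spike[OF \<open>negligible E\<close>, rotated]) (auto simp: g_def)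
qed

text \<open>
  Lebesgue's differentiation theorem on the line. If the difference quotients at the points of \<open>E n\<close>
  are wrong by more than \<open>1 / Suc n\<close>, a Vitali covering of \<open>E n\<close> consists of disjoint intervals on which
  Riemann summand and integral differ by a fixed proportion of the length. Henstock's lemma makes
  the sum of such differences arbitrarily small, hence also the total length.
\<close>

lemma indefinite_integral_has_vector_derivative_ae:
  fixes f :: "real \<Rightarrow> 'a::euclidean_space"
  assumes f: "f integrable_on {a..b}"
  obtains E where "negligible E"
    "\<And>t. t \<in> {a<..<b} - E \<Longrightarrow> ((\<lambda>s. integral {a..s} f) has_vector_derivative f t) (at t)"
proof -
  let ?F = "\<lambda>s. integral {a..s} f"
  define err where "err t s = norm (?F s - ?F t - (s - t) *\<^sub>R f t)" for t s
  define E where "E n = {t \<in> {a<..<b}. \<forall>d>0. \<exists>s\<in>{a<..<b}. s \<noteq> t \<and> \<bar>s - t\<bar> < d \<and>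
      \<bar>s - t\<bar> / Suc n < err t s}" for n
  have neg: "negligible (E n)" for n
    unfolding negligible_outer_le
  proof (intro allI impI)
    fix \<eta> :: real assume "\<eta> > 0"
    define \<epsilon> where "\<epsilon> = 1 / Suc n"
    have "\<epsilon> > 0" by (simp add: \<epsilon>_def)
    obtain \<gamma> where "gauge \<gamma>" and \<gamma>: "\<And>p. p tagged_partial_division_of {a..b} \<Longrightarrow> \<gamma> fine p \<Longrightarrow>
        (\<Sum>(t,K)\<in>p. norm (measure lborel K *\<^sub>R f t - integral K f)) < \<epsilon> * \<eta>"
      using Henstock_lemma[of f a b "\<epsilon> * \<eta>", unfolded box_real, OF f mult_pos_pos[OF \<open>\<epsilon> > 0\<close> \<open>\<eta> > 0\<close>]]
      by blast
    define B where "B i = {min (fst i) (snd i)..max (fst i) (snd i)}" for i :: "real \<times> real"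
    let ?c = "\<lambda>i. (fst i + snd i) / 2 :: real" and ?r = "\<lambda>i. \<bar>snd i - fst i\<bar> / 2 :: real"
    have cball_eq: "cball (?c i) (?r i) = B i" for i
    proof -
      have "?c i - ?r i = min (fst i) (snd i)" "?c i + ?r i = max (fst i) (snd i)"
        by (auto simp: min_def max_def abs_if field_simps)
      then show ?thesis by (simp add: cball_eq_atLeastAtMost B_def)
    qed
    define J where "J = {(t,s). t \<in> {a<..<b} \<and> s \<in> {a<..<b} \<and> s \<noteq> t \<and> \<epsilon> * \<bar>s - t\<bar> < err t s \<and>
        B (t,s) \<subseteq> \<gamma> t}"
    have J1: "?r i > 0" if "i \<in> J" for i
      using that by (auto simp: J_def)
    have J2: "\<exists>i. i \<in> J \<and> t \<in> B i \<and> ?r i < d" if "t \<in> E n" "0 < d" for t d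
    proof -
      obtain \<rho> where "\<rho> > 0" and \<rho>: "ball t \<rho> \<subseteq> \<gamma> t"
        using gaugeD[OF \<open>gauge \<gamma>\<close>, of t] open_contains_ball by blast
      obtain s where s: "s \<in> {a<..<b}" "s \<noteq> t" "\<bar>s - t\<bar> < min d \<rho>" "\<epsilon> * \<bar>s - t\<bar> < err t s"
      proof -
        have "\<exists>s\<in>{a<..<b}. s \<noteq> t \<and> \<bar>s - t\<bar> < min d \<rho> \<and> \<bar>s - t\<bar> / Suc n < err t s"
        proof -
          have any_d: "\<forall>d>0. \<exists>s\<in>{a<..<b}. s \<noteq> t \<and> \<bar>s - t\<bar> < d \<and> \<bar>s - t\<bar> / Suc n < err t s"
            using \<open>t \<in> E n\<close> unfolding E_def mem_Collect_eq by (rule conjunct2)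
          have "0 < min d \<rho>" using \<open>0 < d\<close> \<open>0 < \<rho>\<close> by simp
          then show ?thesis by (rule any_d[THEN spec, THEN mp])
        qed
        then obtain s where "s \<in> {a<..<b}" "s \<noteq> t" "\<bar>s - t\<bar> < min d \<rho>"
            "\<bar>s - t\<bar> / Suc n < err t s"
          by (elim bexE conjE)
        then show ?thesis by (intro that[of s]) (simp_all add: \<epsilon>_def)
      qed
      have "B (t,s) \<subseteq> ball t \<rho>"
        using s by (auto simp: B_def dist_real_def min_def max_def split: if_splits)
      then have "(t,s) \<in> J"
        using s \<rho> \<open>t \<in> E n\<close> by (auto simp: J_def E_def)
      moreover have "t \<in> B (t,s)" "?r (t,s) < d"
        using s by (auto simp: B_def)
      ultimately show ?thesis by blast
    qed
    obtain C where C: "countable C" "C \<subseteq> J" "pairwise (\<lambda>i j. disjnt (B i) (B j)) C"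
        "negligible (E n - (\<Union>i\<in>C. B i))"
      by (rule Vitali_covering_theorem_cballs[of J ?r "E n" ?c, unfolded cball_eq])
        (use J1 J2 in blast)+
    have bound: "measure lebesgue (\<Union>i\<in>I. B i) \<le> \<eta>" if "I \<subseteq> C" "finite I" for I
    proof -
      let ?p = "(\<lambda>i. (fst i, B i)) ` I"
      have inj: "inj_on (\<lambda>i. (fst i, B i)) I"
      proof (rule inj_onI, rule ccontr)
        fix i j assume ij: "i \<in> I" "j \<in> I" "(fst i, B i) = (fst j, B j)" "i \<noteq> j"
        then have "disjnt (B i) (B j)"
          by (intro pairwiseD[OF C(3)]) (use \<open>I \<subseteq> C\<close> in auto)
        then have "B i = {}" using ij(3) by (simp add: disjnt_def)
        then show False by (auto simp: B_def)
      qed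
      have "?p tagged_partial_division_of {a..b}"
        unfolding tagged_partial_division_of_def
      proof (intro conjI allI impI)
        fix t K assume "(t,K) \<in> ?p"
        then obtain i where i: "i \<in> I" "t = fst i" "K = B i" by auto
        then have "i \<in> J" using C that by auto
        then show "t \<in> K" "K \<subseteq> {a..b}" "\<exists>u v. K = cbox u v"
          using i by (auto simp: B_def J_def)
      next
        fix t K t' K' assume *: "(t,K) \<in> ?p \<and> (t',K') \<in> ?p \<and> (t,K) \<noteq> (t',K')"
        then obtain i j where "i \<in> I" "j \<in> I" "K = B i" "K' = B j" "i \<noteq> j" by auto
        then have "disjnt K K'" using pairwiseD[OF C(3), of i j] \<open>I \<subseteq> C\<close> by blast
        then show "interior K \<inter> interior K' = {}"
          using interior_subset by (fastforce simp: disjnt_def)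
      qed (use that in auto)
      moreover have "\<gamma> fine ?p"
      proof -
        have "B i \<subseteq> \<gamma> (fst i)" if "i \<in> J" for i
          using that by (auto simp: J_def)
        then show ?thesis using C(2) \<open>I \<subseteq> C\<close> unfolding fine_def by fastforce
      qed
      ultimately have "(\<Sum>(t,K)\<in>?p. norm (measure lborel K *\<^sub>R f t - integral K f)) < \<epsilon> * \<eta>"
        by (rule \<gamma>)
      then have lt: "(\<Sum>i\<in>I. norm (measure lborel (B i) *\<^sub>R f (fst i) - integral (B i) f)) < \<epsilon> * \<eta>"
        by (subst (asm) sum.reindex[OF inj]) (simp add: o_def case_prod_beta)
      have "\<epsilon> * measure lborel (B i) \<le> norm (measure lborel (B i) *\<^sub>R f (fst i) - integral (B i) f)" if "i \<in> I" for i
      proof -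
        obtain t s where i: "i = (t,s)" by force
        then have J: "(t,s) \<in> J" using that C \<open>I \<subseteq> C\<close> by auto
        then have ts: "a \<le> t" "a \<le> s" "t \<le> b" "s \<le> b" by (auto simp: J_def)
        have Fdiff: "?F v - ?F u = integral {u..v} f" if "a \<le> u" "u \<le> v" "v \<le> b" for u v
        proof -
          have "f integrable_on {a..v}" using f that by (auto intro: integrable_on_subinterval)
          then show ?thesis using Henstock_Kurzweil_Integration.integral_combine[of a u v f] that
            by (auto simp: algebra_simps)
        qed
        have "norm (measure lborel (B i) *\<^sub>R f (fst i) - integral (B i) f) = err t s"
        proof (cases "t \<le> s")
          case True
          then show ?thesis unfolding i B_def err_def using Fdiff[of t s] ts
            by (simp add: norm_minus_commute)
        next
          case False
          then have "norm (?F s - ?F t - (s - t) *\<^sub>R f t) = norm ((t - s) *\<^sub>R f t - (?F t - ?F s))"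
            by (simp add: algebra_simps)
          then show ?thesis unfolding i B_def err_def using Fdiff[of s t] ts False by simp
        qed
        moreover have "measure lborel (B i) = \<bar>s - t\<bar>" unfolding i B_def by (cases "t \<le> s") simp_all
        ultimately show ?thesis using J by (auto simp: J_def)
      qed
      then have "(\<Sum>i\<in>I. \<epsilon> * measure lborel (B i)) < \<epsilon> * \<eta>"
        by (intro order_le_less_trans[OF sum_mono lt])
      then have "(\<Sum>i\<in>I. measure lebesgue (B i)) < \<eta>"
        using \<open>\<epsilon> > 0\<close> unfolding sum_distrib_left[symmetric] by (simp add: B_def)
      moreover have "measure lebesgue (\<Union>i\<in>I. B i) \<le> (\<Sum>i\<in>I. measure lebesgue (B i))"
        using \<open>finite I\<close> by (intro measure_UNION_le) (auto simp: B_def)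
      ultimately show ?thesis by linarith
    qed
    define W where "W = (\<Union>i\<in>C. B i)"
    have W: "W \<in> lmeasurable" "measure lebesgue W \<le> \<eta>"
      unfolding W_def by (rule fmeasurable_UN_bound[OF C(1) _ bound] measure_UN_bound[OF C(1) _ bound]; simp add: B_def)+
    have Z: "E n - W \<in> null_sets lebesgue"
      using C(4) unfolding W_def negligible_iff_null_sets .
    have "W \<union> (E n - W) \<in> lmeasurable"
      using W Z by (intro fmeasurable.Un) (auto intro: fmeasurableI_null_sets)
    moreover have "measure lebesgue (W \<union> (E n - W)) \<le> \<eta>"
      using W Z by (subst measure_Un_null_set) auto
    moreover have "E n \<subseteq> W \<union> (E n - W)" by blast
    ultimately show "\<exists>T. E n \<subseteq> T \<and> T \<in> lmeasurable \<and> measure lebesgue T \<le> \<eta>"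
      by (intro exI conjI)
  qed
  show thesis
  proof (rule that)
    show "negligible (\<Union>n. E n)" using neg by (intro negligible_countable_Union) auto
    fix t assume t: "t \<in> {a<..<b} - (\<Union>n. E n)"
    show "(?F has_vector_derivative f t) (at t)"
      unfolding has_vector_derivative_def has_derivative_at_alt
    proof (intro conjI allI impI bounded_linear_scaleR_left)
      fix e :: real assume "e > 0"
      then obtain n where n: "1 / Suc n < e" using nat_approx_posE by blast
      have "t \<notin> E n" using t by auto
      then obtain d where "d > 0" and d: "\<And>s. s \<in> {a<..<b} \<Longrightarrow> s \<noteq> t \<Longrightarrow> \<bar>s - t\<bar> < d \<Longrightarrow>
          err t s \<le> \<bar>s - t\<bar> / Suc n"
        using t unfolding E_def by (fastforce simp: not_less)
      show "\<exists>d>0. \<forall>s. norm (s - t) < d \<longrightarrow>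
          norm (?F s - ?F t - (s - t) *\<^sub>R f t) \<le> e * norm (s - t)"
      proof (intro exI[of _ "min d (min (t - a) (b - t))"] conjI allI impI)
        fix s assume s: "norm (s - t) < min d (min (t - a) (b - t))"
        show "norm (?F s - ?F t - (s - t) *\<^sub>R f t) \<le> e * norm (s - t)"
        proof (cases "s = t")
          case False
          then have "err t s \<le> \<bar>s - t\<bar> * (1 / Suc n)" using d[of s] s by (auto simp: abs_if split: if_splits)
          also have "\<dots> \<le> \<bar>s - t\<bar> * e" using n by (intro mult_left_mono) auto
          finally show ?thesis by (simp add: err_def mult.commute)
        qed auto
      qed (use \<open>d > 0\<close> t in auto)
    qed
  qed
qed

section \<open>Measurability and estimates up to null sets\<close>

lemma AE_lebesgue_on_iff_negligible:
  fixes S :: "'a::euclidean_space set"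
  assumes "S \<in> sets lebesgue"
  shows "(AE t in lebesgue_on S. P t) \<longleftrightarrow> negligible {t \<in> S. \<not> P t}"
proof -
  have "(AE t in lebesgue_on S. P t) \<longleftrightarrow> (AE t in lebesgue. t \<in> S \<longrightarrow> P t)"
    using assms by (intro AE_restrict_space_iff) simp
  also have "\<dots> \<longleftrightarrow> (\<exists>N\<in>null_sets lebesgue. {t \<in> S. \<not> P t} \<subseteq> N)"
    by (auto simp: eventually_ae_filter)
  also have "\<dots> \<longleftrightarrow> negligible {t \<in> S. \<not> P t}"
    unfolding negligible_iff_null_sets[symmetric] Bex_def
    by (meson negligible_subset order_refl)
  finally show ?thesis .
qed

text \<open>
  Completeness of Lebesgue measure allows measurable functions to be changed on null sets.
\<close>

lemma borel_measurable_lebesgue_on_spike: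
  fixes f g :: "'a::euclidean_space \<Rightarrow> 'b::topological_space"
  assumes f: "f \<in> borel_measurable (lebesgue_on S)" and S: "S \<in> sets lebesgue"
    and N: "negligible N" and eq: "\<And>x. x \<in> S - N \<Longrightarrow> g x = f x"
  shows "g \<in> borel_measurable (lebesgue_on S)"
proof (rule borel_measurableI)
  fix T :: "'b set" assume "open T"
  then have "f -` T \<inter> S \<in> sets lebesgue"
    using measurable_sets[OF f, of T] S by (simp add: space_restrict_space sets_restrict_space_iff)
  moreover have "N \<in> sets lebesgue" "(g -` T \<inter> S) \<inter> N \<in> sets lebesgue"
    using N negligible_subset[OF N, of "(g -` T \<inter> S) \<inter> N"] by (auto simp: negligible_iff_null_sets)
  moreover have "g -` T \<inter> S = ((f -` T \<inter> S) - N) \<union> ((g -` T \<inter> S) \<inter> N)"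
    using eq by auto
  ultimately have "g -` T \<inter> S \<in> sets lebesgue"
    by (metis sets.Diff sets.Un)
  then show "g -` T \<inter> space (lebesgue_on S) \<in> sets (lebesgue_on S)"
    using S by (simp add: space_restrict_space sets_restrict_space_iff)
qed

text \<open>
  The superposition theorem for Caratheodory functions: measurability in \<open>t\<close> for each fixed state
  and continuity in the state suffice along any continuous curve.
\<close>

lemma measurable_superposition:
  fixes f :: "real \<Rightarrow> 'a::metric_space \<Rightarrow> 'b::metric_space"
  assumes meas: "\<And>p. (\<lambda>t. f t p) \<in> borel_measurable (time_measure a b)"
    and E: "negligible E" and cont: "\<And>t. t \<in> {a<..<b} - E \<Longrightarrow> continuous_on UNIV (f t)"
    and x: "continuous_on {a..b} x"
  shows "(\<lambda>t. f t (x t)) \<in> borel_measurable (time_measure a b)"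
proof -
  \<comment> \<open>Sampling \<open>x\<close> at the grid of mesh \<open>1 / Suc n\<close> reduces the claim to countably many states.\<close>
  define grid where "grid n i = a + real_of_int i / Suc n" for n and i :: int
  define k where "k n t = \<lfloor>Suc n * (t - a)\<rfloor>" for n and t :: real
  define g where "g n t = (if t \<in> E then f t (x a) else f t (x (grid n (k n t))))" for n t
  have "(\<lambda>t. f t (x (grid n (k n t)))) \<in> borel_measurable (time_measure a b)" for n
  proof (rule measurable_compose_countable)
    show "k n \<in> time_measure a b \<rightarrow>\<^sub>M count_space UNIV"
      unfolding k_def by (intro measurable_restrict_space1 measurable_completion) measurable
  qed (rule meas)
  then have "g n \<in> borel_measurable (time_measure a b)" for n
    by (rule borel_measurable_lebesgue_on_spike[OF _ _ E]) (auto simp: g_def)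
  then have "(\<lambda>t. if t \<in> E then f t (x a) else f t (x t)) \<in> borel_measurable (time_measure a b)"
  proof (rule borel_measurable_LIMSEQ_metric)
    fix t assume "t \<in> space (time_measure a b)"
    then have t: "t \<in> {a<..<b}" by simp
    show "(\<lambda>n. g n t) \<longlonglongrightarrow> (if t \<in> E then f t (x a) else f t (x t))"
    proof (cases "t \<in> E")
      case False
      have grid: "grid n (k n t) \<le> t \<and> t \<le> grid n (k n t) + 1 / Suc n \<and> a \<le> grid n (k n t)" for n
      proof -
        have "of_int (k n t) \<le> Suc n * (t - a)" "Suc n * (t - a) \<le> of_int (k n t) + 1"
             "0 \<le> k n t"
          using t unfolding k_def by (linarith | simp)+
        then have "of_int (k n t) / Suc n \<le> t - a" "t - a \<le> (of_int (k n t) + 1) / Suc n"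
             "0 \<le> of_int (k n t) / real (Suc n)"
          by (simp_all add: field_simps)
        then show ?thesis by (simp add: grid_def add_divide_distrib)
      qed
      have "(\<lambda>n. grid n (k n t)) \<longlonglongrightarrow> t"
      proof (rule tendsto_sandwich[where h = "\<lambda>_. t" and f = "\<lambda>n. t - 1 / Suc n"])
        show "(\<lambda>n. t - 1 / Suc n) \<longlonglongrightarrow> t"
          using tendsto_diff[OF tendsto_const LIMSEQ_inverse_real_of_nat, of t]
          by (simp add: inverse_eq_divide)
      qed (use grid in \<open>auto simp: algebra_simps intro!: always_eventually\<close>)
      moreover have "grid n (k n t) \<in> {a..b}" for n
        using grid[of n] t by auto
      ultimately have "(\<lambda>n. x (grid n (k n t))) \<longlonglongrightarrow> x t"
        using x t by (intro continuous_on_tendsto_compose[OF x]) (auto intro: always_eventually)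
      then have "(\<lambda>n. f t (x (grid n (k n t)))) \<longlonglongrightarrow> f t (x t)"
        using t False by (intro continuous_on_tendsto_compose[OF cont]) auto
      then show ?thesis using False by (simp add: g_def)
    qed (simp add: g_def)
  qed
  then show ?thesis
    by (rule borel_measurable_lebesgue_on_spike[OF _ _ E]) auto
qed

lemma norm_integral_le_ae:
  fixes g :: "real \<Rightarrow> 'a::euclidean_space"
  assumes "(g has_integral I) S" "h integrable_on S" "negligible N"
    "\<And>t. t \<in> S - N \<Longrightarrow> norm (g t) \<le> h t"
  shows "norm I \<le> integral S h"
proof -
  define g' where "g' t = (if t \<in> N then 0 else g t)" for t
  define h' where "h' t = (if t \<in> N then 0 else h t)" for t
  have g': "(g' has_integral I) S"
    by (rule has_integral_spike[OF assms(3) _ assms(1)]) (auto simp: g'_def)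
  have h': "(h' has_integral integral S h) S"
    by (rule has_integral_spike[OF assms(3) _ integrable_integral[OF assms(2)]]) (auto simp: h'_def)
  have "norm (integral S g') \<le> integral S h'"
    using g' h' assms(4) by (intro integral_norm_bound_integral) (auto simp: g'_def h'_def)
  then show ?thesis using g' h' by (simp add: integral_unique)
qed

section \<open>Gronwall's inequality\<close>

lemma gronwall_forward:
  fixes \<phi> :: "real \<Rightarrow> real"
  assumes "s \<le> t" and cont: "continuous_on {s..t} \<phi>" and "L \<ge> 0" "K \<ge> 0"
    and le: "\<And>r. r \<in> {s..t} \<Longrightarrow> \<phi> r \<le> A + integral {s..r} (\<lambda>q. L * \<phi> q + K)"
  shows "\<phi> t \<le> (A + K * (t - s)) * exp (L * (t - s))"
proof -
  define G where "G r = A + integral {s..r} (\<lambda>q. L * \<phi> q + K)" for r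
  define H where "H r = G r * exp (- L * (r - s)) - K * (r - s)" for r
  have contLK: "continuous_on {s..t} (\<lambda>q. L * \<phi> q + K)"
    by (intro continuous_intros cont)
  have G: "(G has_real_derivative L * \<phi> r + K) (at r)" if "s < r" "r < t" for r
  proof -
    have "((\<lambda>r. integral {s..r} (\<lambda>q. L * \<phi> q + K)) has_real_derivative L * \<phi> r + K) (at r within {s..t})"
      using that by (intro integral_has_real_derivative contLK) auto
    then have "(G has_real_derivative L * \<phi> r + K) (at r within {s..t})"
      unfolding G_def by (auto intro!: derivative_eq_intros)
    then show ?thesis using that at_within_Icc_at[of s r t] by simp
  qed
  have "H t \<le> H s"
  proof (rule DERIV_nonpos_imp_decreasing_open[OF \<open>s \<le> t\<close>])
    fix r assume r: "s < r" "r < t"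
    let ?D = "(L * \<phi> r + K) * exp (- L * (r - s)) - L * G r * exp (- L * (r - s)) - K"
    have "(H has_real_derivative ?D) (at r)"
      unfolding H_def using G[OF r] by (auto intro!: derivative_eq_intros)
    moreover have "?D \<le> 0"
    proof -
      have "(L * \<phi> r + K - L * G r) * exp (- L * (r - s)) \<le> K * 1"
        using le[of r] r \<open>L \<ge> 0\<close> \<open>K \<ge> 0\<close>
        by (intro mult_mono) (auto simp: G_def mult_left_mono)
      then show ?thesis by (simp add: algebra_simps)
    qed
    ultimately show "\<exists>y. (H has_real_derivative y) (at r) \<and> y \<le> 0" by blast
  next
    show "continuous_on {s..t} H"
      unfolding H_def G_def
      by (intro continuous_intros indefinite_integral_continuous_1 integrable_continuous_real contLK)
  qed
  then have "G t * exp (- L * (t - s)) \<le> A + K * (t - s)"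
    by (simp add: H_def G_def)
  then have "G t * exp (- L * (t - s)) * exp (L * (t - s)) \<le> (A + K * (t - s)) * exp (L * (t - s))"
    by (intro mult_right_mono) auto
  then have "G t \<le> (A + K * (t - s)) * exp (L * (t - s))"
    by (simp add: mult.assoc exp_add[symmetric])
  then show ?thesis using le[of t] \<open>s \<le> t\<close> by (simp add: G_def)
qed

text \<open>
  The estimate runs in both time directions from any base point \<open>s\<close>, since flows are evaluated
  both forwards and backwards. The inhomogeneity \<open>K\<close> serves the linearisation error of the flow.
\<close>

lemma gronwall:
  fixes w :: "real \<Rightarrow> 'a::euclidean_space"
  assumes w: "\<And>r t. a \<le> r \<Longrightarrow> r \<le> t \<Longrightarrow> t \<le> b \<Longrightarrow> (w' has_integral (w t - w r)) {r..t}"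
    and cont: "continuous_on {a..b} w" and "negligible N" and "L \<ge> 0" "K \<ge> 0"
    and w': "\<And>t. t \<in> {a..b} - N \<Longrightarrow> norm (w' t) \<le> L * norm (w t) + K"
    and st: "s \<in> {a..b}" "t \<in> {a..b}"
  shows "norm (w t) \<le> (norm (w s) + K * \<bar>t - s\<bar>) * exp (L * \<bar>t - s\<bar>)"
proof -
  let ?h = "\<lambda>q. L * norm (w q) + K"
  have cont_sub: "continuous_on {r..q} w" if "a \<le> r" "q \<le> b" for r q
    using cont by (rule continuous_on_subset) (use that in auto)
  have incr: "norm (w q - w r) \<le> integral {r..q} ?h" if "a \<le> r" "r \<le> q" "q \<le> b" for r q
    using that w' by (intro norm_integral_le_ae[OF w _ \<open>negligible N\<close>] integrable_continuous_real
        continuous_intros cont_sub) auto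
  show ?thesis
  proof (cases "s \<le> t")
    case True
    have "norm (w t) \<le> (norm (w s) + K * (t - s)) * exp (L * (t - s))"
    proof (rule gronwall_forward[where \<phi> = "\<lambda>r. norm (w r)", OF True _ \<open>L \<ge> 0\<close> \<open>K \<ge> 0\<close>])
      show "continuous_on {s..t} (\<lambda>t. norm (w t))"
        using st by (intro continuous_intros cont_sub) auto
      fix r assume "r \<in> {s..t}"
      then have "norm (w r - w s) \<le> integral {s..r} ?h"
        using st by (intro incr) auto
      then show "norm (w r) \<le> norm (w s) + integral {s..r} ?h"
        using norm_triangle_ineq2[of "w r" "w s"] by linarith
    qed
    then show ?thesis using True by simp
  next
    case False
    \<comment> \<open>Backwards in time, the forward estimate applies to the reflected function.\<close>
    have "norm (w (- (- t))) \<le> (norm (w s) + K * (- t - (- s))) * exp (L * (- t - (- s)))"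
    proof (rule gronwall_forward[where \<phi> = "\<lambda>r. norm (w (- r))", OF _ _ \<open>L \<ge> 0\<close> \<open>K \<ge> 0\<close>])
      show "- s \<le> - t" using False by simp
      have "uminus ` {- s..- t} \<subseteq> {a..b}"
        using st by auto
      then show "continuous_on {- s..- t} (\<lambda>r. norm (w (- r)))"
        by (rule continuous_on_norm[OF continuous_on_compose2[OF cont
              continuous_on_minus[OF continuous_on_id]]])
      fix r assume "r \<in> {- s..- t}"
      then have "norm (w s - w (- r)) \<le> integral {- r..s} ?h"
        using st by (intro incr) auto
      also have "\<dots> = integral {- s..- (- r)} (\<lambda>q. ?h (- q))"
        by (rule Henstock_Kurzweil_Integration.integral_reflect_real[where f = ?h, symmetric])
      finally show "norm (w (- r)) \<le> norm (w s) + integral {- s..r} (\<lambda>q. L * norm (w (- q)) + K)"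
        using norm_triangle_ineq3[of "w s" "w (- r)"] by simp
    qed
    then show ?thesis using False by simp
  qed
qed

section \<open>Caratheodory differential equations\<close>

text \<open>
  The set \<open>E\<close> collects the exceptional times. The bound at the single state \<open>0\<close> and the Lipschitz
  condition give linear growth, hence solutions on all of \<open>[a,b]\<close>.
\<close>

locale caratheodory_field =
  fixes a b :: real and f :: "real \<Rightarrow> 'a::euclidean_space \<Rightarrow> 'a" and L M :: real and E :: "real set"
  assumes ab: "a < b" and L: "L \<ge> 0" and M: "M \<ge> 0" and E: "negligible E"
    and meas: "\<And>p. (\<lambda>t. f t p) \<in> borel_measurable (time_measure a b)"
    and lip: "\<And>t p q. t \<in> {a<..<b} - E \<Longrightarrow> norm (f t p - f t q) \<le> L * norm (p - q)"
    and bnd: "\<And>t. t \<in> {a<..<b} - E \<Longrightarrow> norm (f t 0) \<le> M"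
begin

lemma negligible_exceptional: "negligible (E \<union> {a,b})"
  using E by (simp add: negligible_Un)

lemma growth:
  assumes "t \<in> {a<..<b} - E"
  shows "norm (f t p) \<le> L * norm p + M"
  using lip[OF assms, of p 0] bnd[OF assms] norm_triangle_sub[of "f t p" "f t 0"] by simp

lemma measurable_along:
  assumes "continuous_on {a..b} x"
  shows "(\<lambda>t. f t (x t)) \<in> borel_measurable (time_measure a b)"
  using meas E _ assms
proof (rule measurable_superposition)
  fix t assume t: "t \<in> {a<..<b} - E"
  show "continuous_on UNIV (f t)"
    by (rule lipschitz_on_continuous_on[of L]) (use lip[OF t] L in \<open>auto simp: lipschitz_on_def dist_norm\<close>)
qed

lemma bounded_along:
  assumes x: "continuous_on {a..b} x"
  obtains R where "R \<ge> 0" "\<And>t. t \<in> {a..b} - (E \<union> {a,b}) \<Longrightarrow> norm (f t (x t)) \<le> R"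
proof -
  have "bounded (x ` {a..b})"
    using x by (intro compact_imp_bounded compact_continuous_image) auto
  then obtain C where C: "\<And>t. t \<in> {a..b} \<Longrightarrow> norm (x t) \<le> C"
    unfolding bounded_iff by blast
  have "C \<ge> 0" using C[of a] ab norm_ge_zero[of "x a"] by (metis atLeastAtMost_iff less_imp_le order_refl order_trans)
  show thesis
  proof (rule that)
    show "L * C + M \<ge> 0" using L M \<open>C \<ge> 0\<close> by simp
    fix t assume t: "t \<in> {a..b} - (E \<union> {a,b})"
    then have "norm (f t (x t)) \<le> L * norm (x t) + M" by (intro growth) auto
    also have "\<dots> \<le> L * C + M" using C t L by (intro add_right_mono mult_left_mono) auto
    finally show "norm (f t (x t)) \<le> L * C + M" .
  qed
qed

lemma integrable_along:
  assumes x: "continuous_on {a..b} x" and "a \<le> r" "t \<le> b"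
  shows "(\<lambda>t. f t (x t)) integrable_on {r..t}"
proof -
  obtain R where R: "R \<ge> 0" "\<And>t. t \<in> {a..b} - (E \<union> {a,b}) \<Longrightarrow> norm (f t (x t)) \<le> R"
    using bounded_along[OF x] by blast
  let ?g = "\<lambda>t. if t \<in> E then 0 else f t (x t)"
  have "?g integrable_on {a<..<b}"
  proof (rule measurable_bounded_by_integrable_imp_integrable)
    show "?g \<in> borel_measurable (time_measure a b)"
      by (rule borel_measurable_lebesgue_on_spike[OF measurable_along[OF x] _ E]) auto
    show "(\<lambda>t. R) integrable_on {a<..<b}"
      by (simp add: integrable_on_open_interval_real[symmetric] integrable_on_const flip: box_real)
    show "norm (?g t) \<le> R" if "t \<in> {a<..<b}" for t
      using R that by auto
  qed simp
  then have "?g integrable_on {a..b}"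
    by (simp add: integrable_on_Icc_iff_Ioo)
  then have "(\<lambda>t. f t (x t)) integrable_on {a..b}"
    by (rule integrable_spike[OF _ E]) auto
  then show ?thesis
    by (rule integrable_subinterval_real) (use assms in auto)
qed

definition integral_solution :: "(real \<Rightarrow> 'a) \<Rightarrow> bool" where
  "integral_solution x \<longleftrightarrow> continuous_on {a..b} x \<and>
     (\<forall>r t. a \<le> r \<longrightarrow> r \<le> t \<longrightarrow> t \<le> b \<longrightarrow> ((\<lambda>t. f t (x t)) has_integral (x t - x r)) {r..t})"

text \<open>
  Passing to the integral equation removes exceptional times and absolute continuity from all later
  arguments: sums, multiples and differences of solutions are handled by linearity of the integral.
\<close>

lemma is_ode_solution_iff:
  "is_ode_solution a b f s p x \<longleftrightarrow> integral_solution x \<and> x s = p"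
proof
  assume sol: "is_ode_solution a b f s p x"
  then have ac: "abs_continuous_on a b x" by (simp add: is_ode_solution_def)
  have "continuous_on {a..b} x"
    unfolding continuous_on_iff
  proof (intro ballI allI impI)
    fix t and e :: real assume "t \<in> {a..b}" "e > 0"
    obtain d where "d > 0" and d: "\<And>S D. D division_of S \<Longrightarrow> S \<subseteq> {a..b} \<Longrightarrow>
        (\<Sum>K\<in>D. Sup K - Inf K) < d \<Longrightarrow> (\<Sum>K\<in>D. norm (x (Sup K) - x (Inf K))) < e"
      using ac \<open>e > 0\<close> unfolding abs_continuous_on_def by meson
    have "norm (x v - x u) < e \<and> norm (x u - x v) < e" if "a \<le> u" "u \<le> v" "v \<le> b" "v - u < d" for u v
      using d[of "{{u..v}}" "{u..v}"] that division_of_self[of u v] by (simp add: box_real norm_minus_commute)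
    then have "dist (x t') (x t) < e" if "t' \<in> {a..b}" "dist t' t < d" for t'
      using that \<open>t \<in> {a..b}\<close> by (cases "t' \<le> t") (auto simp: dist_norm)
    then show "\<exists>d>0. \<forall>t'\<in>{a..b}. dist t' t < d \<longrightarrow> dist (x t') (x t) < e"
      using \<open>d > 0\<close> by blast
  qed
  moreover have "((\<lambda>t. f t (x t)) has_integral (x t - x r)) {r..t}"
    if rt: "a \<le> r" "r \<le> t" "t \<le> b" for r t
  proof (rule abs_continuous_on_has_integral)
    let ?N = "{t \<in> {a<..<b}. \<not> (x has_vector_derivative f t (x t)) (at t)}"
    show "negligible (?N \<union> {a,b})"
      using sol unfolding is_ode_solution_def
      by (simp add: AE_lebesgue_on_iff_negligible negligible_Un)
    show "(x has_vector_derivative f q (x q)) (at q within {r..t})" if "q \<in> {r..t} - (?N \<union> {a,b})" for q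
    proof (rule has_vector_derivative_at_within)
      have "q \<in> {a<..<b}" "q \<notin> ?N" using that rt by auto
      then show "(x has_vector_derivative f q (x q)) (at q)" by blast
    qed
    show "abs_continuous_on r t x"
      using rt by (intro abs_continuous_on_subset[OF ac]) auto
  qed (use rt in auto)
  ultimately show "integral_solution x \<and> x s = p"
    using sol by (simp add: integral_solution_def is_ode_solution_def)
next
  assume sol: "integral_solution x \<and> x s = p"
  then have x: "continuous_on {a..b} x"
    and int: "\<And>r t. a \<le> r \<Longrightarrow> r \<le> t \<Longrightarrow> t \<le> b \<Longrightarrow> ((\<lambda>t. f t (x t)) has_integral (x t - x r)) {r..t}"
    by (auto simp: integral_solution_def)
  obtain R where R: "R \<ge> 0" "\<And>t. t \<in> {a..b} - (E \<union> {a,b}) \<Longrightarrow> norm (f t (x t)) \<le> R"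
    using bounded_along[OF x] by blast
  have lipx: "norm (x t - x r) \<le> R * (t - r)" if "a \<le> r" "r \<le> t" "t \<le> b" for r t
  proof -
    have "norm (x t - x r) \<le> integral {r..t} (\<lambda>_. R)"
      using that R by (intro norm_integral_le_ae[OF int _ negligible_exceptional]) auto
    then show ?thesis using that by (simp add: mult.commute)
  qed
  have "abs_continuous_on a b x"
    unfolding abs_continuous_on_def
  proof (intro allI impI)
    fix e :: real assume "e > 0"
    show "\<exists>d>0. \<forall>S D. D division_of S \<and> S \<subseteq> {a..b} \<and> (\<Sum>K\<in>D. Sup K - Inf K) < d \<longrightarrow>
        (\<Sum>K\<in>D. norm (x (Sup K) - x (Inf K))) < e"
    proof (intro exI[of _ "e / (R + 1)"] conjI allI impI)
      show "0 < e / (R + 1)" using \<open>e > 0\<close> R by simp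
      fix S D assume D: "D division_of S \<and> S \<subseteq> {a..b} \<and> (\<Sum>K\<in>D. Sup K - Inf K) < e / (R + 1)"
      have K: "norm (x (Sup K) - x (Inf K)) \<le> R * (Sup K - Inf K) \<and> 0 \<le> Sup K - Inf K" if "K \<in> D" for K
      proof -
        have "K \<subseteq> {a..b}" "K \<noteq> {}" using D that division_ofD(2,3)[of D S K] by auto
        moreover obtain u v where "K = cbox u v"
          using D \<open>K \<in> D\<close> division_ofD(4)[of D S K] by metis
        ultimately show ?thesis using lipx[of u v] by auto
      qed
      have "(\<Sum>K\<in>D. norm (x (Sup K) - x (Inf K))) \<le> (\<Sum>K\<in>D. R * (Sup K - Inf K))"
        using K by (intro sum_mono) auto
      also have "\<dots> = R * (\<Sum>K\<in>D. Sup K - Inf K)"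
        by (rule sum_distrib_left[symmetric])
      also have "\<dots> \<le> (R + 1) * (\<Sum>K\<in>D. Sup K - Inf K)"
        using K by (intro mult_right_mono sum_nonneg) auto
      also have "\<dots> < (R + 1) * (e / (R + 1))"
        using D R by (intro mult_strict_left_mono) auto
      also have "\<dots> = e" using R by simp
      finally show "(\<Sum>K\<in>D. norm (x (Sup K) - x (Inf K))) < e" .
    qed
  qed
  moreover have "AE t in time_measure a b. (x has_vector_derivative f t (x t)) (at t)"
  proof -
    obtain N where N: "negligible N" "\<And>t. t \<in> {a<..<b} - N \<Longrightarrow>
        ((\<lambda>r. integral {a..r} (\<lambda>t. f t (x t))) has_vector_derivative f t (x t)) (at t)"
      using indefinite_integral_has_vector_derivative_ae[OF integrable_along[OF x order_refl order_refl]]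
      by blast
    have "(x has_vector_derivative f t (x t)) (at t)" if t: "t \<in> {a<..<b} - N" for t
    proof (rule has_vector_derivative_transform_within_open)
      show "((\<lambda>r. x a + integral {a..r} (\<lambda>t. f t (x t))) has_vector_derivative f t (x t)) (at t)"
        using N(2)[OF t] by (auto intro!: derivative_eq_intros)
      show "x a + integral {a..r} (\<lambda>t. f t (x t)) = x r" if "r \<in> {a<..<b}" for r
        using int[of a r] that by (simp add: integral_unique)
    qed (use t in auto)
    then have "{t \<in> {a<..<b}. \<not> (x has_vector_derivative f t (x t)) (at t)} \<subseteq> N"
      by blast
    then show ?thesis
      using N(1) by (simp add: AE_lebesgue_on_iff_negligible negligible_subset)
  qed
  ultimately show "is_ode_solution a b f s p x"
    using sol by (simp add: is_ode_solution_def)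
qed

text \<open>
  Gronwall's inequality for the difference of two solutions. With \<open>x s = y s\<close> this is uniqueness;
  with \<open>s\<close> and \<open>t\<close> exchanged it says that solutions do not approach each other too fast.
\<close>

lemma solutions_close:
  assumes x: "integral_solution x" and y: "integral_solution y"
    and st: "s \<in> {a..b}" "t \<in> {a..b}"
  shows "norm (x t - y t) \<le> exp (L * \<bar>t - s\<bar>) * norm (x s - y s)"
proof -
  have "norm (x t - y t) \<le> (norm (x s - y s) + 0 * \<bar>t - s\<bar>) * exp (L * \<bar>t - s\<bar>)"
  proof (rule gronwall[where w = "\<lambda>t. x t - y t" and w' = "\<lambda>t. f t (x t) - f t (y t)"])
    fix r t assume "a \<le> r" "r \<le> t" "t \<le> b"
    then have "((\<lambda>t. f t (x t) - f t (y t)) has_integral (x t - x r - (y t - y r))) {r..t}"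
      using x y by (intro has_integral_diff) (auto simp: integral_solution_def)
    then show "((\<lambda>t. f t (x t) - f t (y t)) has_integral (x t - y t - (x r - y r))) {r..t}"
      by (simp add: algebra_simps)
  next
    show "continuous_on {a..b} (\<lambda>t. x t - y t)"
      using x y by (intro continuous_intros) (auto simp: integral_solution_def)
    show "norm (f t (x t) - f t (y t)) \<le> L * norm (x t - y t) + 0" if "t \<in> {a..b} - (E \<union> {a,b})" for t
      using lip[of t "x t" "y t"] that by auto
  qed (use L st negligible_exceptional in auto)
  then show ?thesis by (simp add: mult.commute)
qed

text \<open>
  Integrating against the weight \<open>exp (K * \<bar>r - s\<bar>)\<close> gains the factor \<open>1 / K\<close>, which is what turns
  the Picard operator into a contraction on the whole interval.
\<close>

lemma weighted_integral_bound:
  fixes g :: "real \<Rightarrow> 'a"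
  assumes g: "g integrable_on {a..b}" and "negligible N" "K > 0" "D \<ge> 0"
    and le: "\<And>r. r \<in> {a..b} - N \<Longrightarrow> norm (g r) \<le> D * exp (K * \<bar>r - s\<bar>)"
    and st: "s \<in> {a..b}" "t \<in> {a..b}"
  shows "norm (integral {a..t} g - integral {a..s} g) \<le> D / K * exp (K * \<bar>t - s\<bar>)"
proof -
  have int: "g integrable_on {r..q}" if "a \<le> r" "q \<le> b" for r q
    using g that by (auto intro: integrable_subinterval_real)
  have comb: "integral {a..q} g - integral {a..r} g = integral {r..q} g" if "a \<le> r" "r \<le> q" "q \<le> b" for r q
    using Henstock_Kurzweil_Integration.integral_combine[of a r q g] that int[of a q] by (simp add: algebra_simps)
  show ?thesis
  proof (cases "s \<le> t")
    case True
    have I: "((\<lambda>r. D * exp (K * (r - s))) has_integral (D / K * exp (K * (t - s)) - D / K * exp (K * (s - s)))) {s..t}"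
      using \<open>K > 0\<close> True by (intro fundamental_theorem_of_calculus)
        (auto intro!: derivative_eq_intros simp: has_real_derivative_iff_has_vector_derivative[symmetric])
    have "norm (g r) \<le> D * exp (K * (r - s))" if "r \<in> {s..t} - N" for r
      using le[of r] that st by auto
    then have "norm (integral {s..t} g) \<le> integral {s..t} (\<lambda>r. D * exp (K * (r - s)))"
      using st I by (intro norm_integral_le_ae[OF integrable_integral[OF int] _ \<open>negligible N\<close>]) auto
    also have "\<dots> \<le> D / K * exp (K * \<bar>t - s\<bar>)"
      unfolding integral_unique[OF I] using \<open>K > 0\<close> \<open>D \<ge> 0\<close> True by simp
    finally show ?thesis using comb[of s t] st True by simp
  next
    case False
    have I: "((\<lambda>r. D * exp (K * (s - r))) has_integral (- D / K * exp (K * (s - s)) - - D / K * exp (K * (s - t)))) {t..s}"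
      using \<open>K > 0\<close> False by (intro fundamental_theorem_of_calculus)
        (auto intro!: derivative_eq_intros simp: has_real_derivative_iff_has_vector_derivative[symmetric])
    have "norm (g r) \<le> D * exp (K * (s - r))" if "r \<in> {t..s} - N" for r
      using le[of r] that st by auto
    then have "norm (integral {t..s} g) \<le> integral {t..s} (\<lambda>r. D * exp (K * (s - r)))"
      using st I by (intro norm_integral_le_ae[OF integrable_integral[OF int] _ \<open>negligible N\<close>]) auto
    also have "\<dots> \<le> D / K * exp (K * \<bar>t - s\<bar>)"
      unfolding integral_unique[OF I] using \<open>K > 0\<close> \<open>D \<ge> 0\<close> False by simp
    finally show ?thesis using comb[of t s] st False by (simp add: norm_minus_commute)
  qed
qed

text \<open>
  Bielecki's argument: in the sup norm with weight \<open>exp (- K * \<bar>t - s\<bar>)\<close> the Picard operator has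
  Lipschitz constant at most \<open>L / K\<close>, which is less than \<open>1/2\<close> for \<open>K = 2 * L + 1\<close>. Curves on
  \<open>[a,b]\<close> are represented by bounded continuous functions on the line, frozen outside \<open>[a,b]\<close>.
\<close>

lemma solution_exists:
  assumes s: "s \<in> {a..b}"
  shows "\<exists>x. integral_solution x \<and> x s = p"
proof -
  define K where "K = 2 * L + 1"
  have "K > 0" using L by (simp add: K_def)
  define c where "c t = max a (min b t)" for t
  have c: "c t \<in> {a..b}" "continuous_on UNIV c" for t
    using ab unfolding c_def by (auto intro!: continuous_intros)
  have c_id: "c t = t" if "t \<in> {a..b}" for t using that by (auto simp: c_def)
  \<comment> \<open>\<open>z\<close> stands for the curve divided by the weight \<open>exp (K * \<bar>t - s\<bar>)\<close>.\<close>
  define X where "X z t = exp (K * \<bar>t - s\<bar>) *\<^sub>R apply_bcontfun z t" for z :: "real \<Rightarrow>\<^sub>C 'a" and t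
  define F where "F z t = integral {a..t} (\<lambda>r. f r (X z r))" for z t
  define q where "q z t = exp (- K * \<bar>c t - s\<bar>) *\<^sub>R (p + F z (c t) - F z s)" for z t
  have X: "continuous_on S (X z)" for z S
    unfolding X_def by (intro continuous_intros) auto
  have F: "continuous_on {a..b} (F z)" for z
    unfolding F_def by (intro indefinite_integral_continuous_1 integrable_along X) auto
  have q: "q z \<in> bcontfun" for z
  proof -
    have cont: "continuous_on {a..b} (\<lambda>t. exp (- K * \<bar>t - s\<bar>) *\<^sub>R (p + F z t - F z s))"
      by (intro continuous_intros F)
    have "bounded ((\<lambda>t. exp (- K * \<bar>t - s\<bar>) *\<^sub>R (p + F z t - F z s)) ` {a..b})"
      by (intro compact_imp_bounded compact_continuous_image cont) simp
    then obtain C where "\<And>t. t \<in> {a..b} \<Longrightarrow> norm (exp (- K * \<bar>t - s\<bar>) *\<^sub>R (p + F z t - F z s)) \<le> C"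
      unfolding bounded_iff by blast
    then have "norm (q z t) \<le> C" for t
      using c unfolding q_def by blast
    moreover have "continuous_on UNIV (q z)"
      unfolding q_def by (rule continuous_on_compose2[OF cont c(2)]) (use c in auto)
    ultimately show ?thesis by (intro bcontfun_normI)
  qed
  define Q where "Q z = Bcontfun (q z)" for z
  have Q: "apply_bcontfun (Q z) = q z" for z
    unfolding Q_def using q by (rule Bcontfun_inverse)
  have "dist (Q z) (Q z') \<le> 1/2 * dist z z'" for z z'
  proof (rule dist_bound)
    fix t
    let ?g = "\<lambda>r. f r (X z r) - f r (X z' r)"
    have g: "?g integrable_on {a..b}"
      by (intro integrable_diff integrable_along X) auto
    have "norm (?g r) \<le> (L * dist z z') * exp (K * \<bar>r - s\<bar>)" if "r \<in> {a..b} - (E \<union> {a,b})" for r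
    proof -
      have "norm (?g r) \<le> L * norm (X z r - X z' r)"
        using that by (intro lip) auto
      also have "L * norm (X z r - X z' r) = L * ( exp (K * \<bar>r - s\<bar>) * dist (apply_bcontfun z r) (apply_bcontfun z' r))"
        by (simp add: X_def dist_norm flip: scaleR_diff_right)
      also have "\<dots> \<le> L * (exp (K * \<bar>r - s\<bar>) * dist z z')"
        using L by (intro mult_left_mono dist_bounded) auto
      finally show ?thesis by (simp add: mult.commute mult.left_commute)
    qed
    then have *: "norm (integral {a..c t} ?g - integral {a..s} ?g) \<le> (L * dist z z') / K * exp (K * \<bar>c t - s\<bar>)"
      using c s L \<open>K > 0\<close> by (intro weighted_integral_bound[OF g negligible_exceptional]) auto
    have F_diff: "integral {a..r} ?g = F z r - F z' r" if "r \<in> {a..b}" for r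
      unfolding F_def using that by (intro integral_diff integrable_along X) auto
    have "dist (q z t) (q z' t)
        = exp (- K * \<bar>c t - s\<bar>) * norm (integral {a..c t} ?g - integral {a..s} ?g)"
    proof -
      have "q z t - q z' t = exp (- K * \<bar>c t - s\<bar>) *\<^sub>R (integral {a..c t} ?g - integral {a..s} ?g)"
        unfolding q_def F_diff[OF c(1)] F_diff[OF s] by (simp add: algebra_simps)
      then show ?thesis by (simp add: dist_norm)
    qed
    also have "\<dots> \<le> exp (- K * \<bar>c t - s\<bar>) * ((L * dist z z') / K * exp (K * \<bar>c t - s\<bar>))"
      by (intro mult_left_mono *) auto
    also have "\<dots> = L / K * dist z z'"
      by (simp add: exp_minus field_simps)
    also have "\<dots> \<le> 1/2 * dist z z'"
      using L by (intro mult_right_mono) (auto simp: K_def field_simps)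
    finally show "dist (apply_bcontfun (Q z) t) (apply_bcontfun (Q z') t) \<le> 1/2 * dist z z'"
      by (simp add: Q)
  qed
  then obtain z where z: "Q z = z"
    using banach_fix_type[of "1/2" Q] by auto
  have eq: "X z t = p + F z t - F z s" if "t \<in> {a..b}" for t
  proof -
    have "apply_bcontfun z t = exp (- K * \<bar>t - s\<bar>) *\<^sub>R (p + F z t - F z s)"
      using fun_cong[OF Q, of z t] c_id[OF that] by (simp add: z q_def)
    then show ?thesis by (simp add: X_def exp_minus)
  qed
  have "integral_solution (X z)"
    unfolding integral_solution_def
  proof (intro conjI allI impI X)
    fix r t assume rt: "a \<le> r" "r \<le> t" "t \<le> b"
    have *: "F z r + integral {r..t} (\<lambda>r. f r (X z r)) = F z t"
      unfolding F_def using rt by (intro Henstock_Kurzweil_Integration.integral_combine integrable_along X) auto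
    have "integral {r..t} (\<lambda>r. f r (X z r)) = X z t - X z r"
    proof -
      have "X z t - X z r = F z t - F z r"
        using eq[of t] eq[of r] rt by simp
      with * show ?thesis by (metis add_diff_cancel_left')
    qed
    then show "((\<lambda>t. f t (X z t)) has_integral (X z t - X z r)) {r..t}"
      using integrable_integral[OF integrable_along[OF X[of _ z], of r t]] rt by simp
  qed
  moreover have "X z s = p" using eq[OF s] by simp
  ultimately show ?thesis by blast
qed

lemma ode_solution:
  assumes "s \<in> {a..b}"
  shows "integral_solution (ode_solution a b f s p)" "ode_solution a b f s p s = p"
proof -
  have "is_ode_solution a b f s p (ode_solution a b f s p)"
    unfolding ode_solution_def is_ode_solution_iff using solution_exists[OF assms] by (rule someI_ex)
  then show "integral_solution (ode_solution a b f s p)" "ode_solution a b f s p s = p"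
    by (auto simp: is_ode_solution_iff)
qed

end

section \<open>Derivatives from remainders and difference quotients\<close>

lemma has_derivative_quadratic_remainder:
  fixes g :: "'a::real_normed_vector \<Rightarrow> 'b::real_normed_vector"
  assumes D: "bounded_linear D" and "C \<ge> 0" and le: "\<And>h. norm (g (p + h) - g p - D h) \<le> C * (norm h)\<^sup>2"
  shows "(g has_derivative D) (at p)"
  unfolding has_derivative_at_alt
proof (intro conjI D allI impI)
  fix e :: real assume "e > 0"
  show "\<exists>d>0. \<forall>y. norm (y - p) < d \<longrightarrow> norm (g y - g p - D (y - p)) \<le> e * norm (y - p)"
  proof (intro exI[of _ "e / (C + 1)"] conjI allI impI)
    show "e / (C + 1) > 0" using \<open>e > 0\<close> \<open>C \<ge> 0\<close> by simp
    fix y assume y: "norm (y - p) < e / (C + 1)"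
    have "norm (g y - g p - D (y - p)) \<le> C * norm (y - p) * norm (y - p)"
      using le[of "y - p"] by (simp add: power2_eq_square)
    also have "\<dots> \<le> e * norm (y - p)"
    proof (rule mult_right_mono)
      have "C * norm (y - p) \<le> (C + 1) * norm (y - p)" by (simp add: mult_right_mono)
      also have "\<dots> \<le> e" using y \<open>C \<ge> 0\<close> by (simp add: pos_less_divide_eq mult.commute)
      finally show "C * norm (y - p) \<le> e" .
    qed simp
    finally show "norm (g y - g p - D (y - p)) \<le> e * norm (y - p)" .
  qed
qed

text \<open>
  A sequence of steps, rather than a limit over all steps, because limits of sequences preserve
  measurability.
\<close>

lemma has_derivative_difference_quotients:
  fixes g :: "'a::real_normed_vector \<Rightarrow> 'b::real_normed_vector"
  assumes g: "(g has_derivative D) (at p)"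
  shows "(\<lambda>n. real (Suc n) *\<^sub>R (g (p + (1 / Suc n) *\<^sub>R h) - g p)) \<longlonglongrightarrow> D h"
proof (cases "h = 0")
  case True
  then show ?thesis
    using linear_0[OF bounded_linear.linear[OF has_derivative_bounded_linear[OF g]]] by simp
next
  case False
  interpret D: bounded_linear D using g by (rule has_derivative_bounded_linear)
  let ?k = "\<lambda>n. (1 / Suc n) *\<^sub>R h"
  have "?k \<longlonglongrightarrow> 0 *\<^sub>R h"
    by (intro tendsto_scaleR tendsto_const) (use LIMSEQ_inverse_real_of_nat in \<open>simp add: inverse_eq_divide\<close>)
  then have "filterlim ?k (at 0) sequentially"
    using False by (auto simp: filterlim_at intro: always_eventually)
  moreover have "((\<lambda>k. norm (g (p + k) - g p - D k) / norm k) \<longlongrightarrow> 0) (at 0)"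
    using g by (simp add: has_derivative_at)
  ultimately have "(\<lambda>n. norm (g (p + ?k n) - g p - D (?k n)) / norm (?k n)) \<longlonglongrightarrow> 0"
    by (rule filterlim_compose[rotated])
  then have "(\<lambda>n. norm (g (p + ?k n) - g p - D (?k n)) / norm (?k n) * norm h) \<longlonglongrightarrow> 0 * norm h"
    by (intro tendsto_intros)
  moreover have "norm (g (p + ?k n) - g p - D (?k n)) / norm (?k n) * norm h =
      norm (real (Suc n) *\<^sub>R (g (p + ?k n) - g p) - D h)" for n
  proof -
    have "real (Suc n) *\<^sub>R (g (p + ?k n) - g p) - D h = real (Suc n) *\<^sub>R (g (p + ?k n) - g p - D (?k n))"
      by (simp add: D.scaleR scaleR_diff_right)
    then have "norm (real (Suc n) *\<^sub>R (g (p + ?k n) - g p) - D h)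
        = real (Suc n) * norm (g (p + ?k n) - g p - D (?k n))"
      by (simp only: norm_scaleR)
    then show ?thesis using False by (simp add: field_simps)
  qed
  ultimately show ?thesis
    by (simp only: mult_zero_left) (simp add: tendsto_norm_zero_iff LIM_zero_iff)
qed

context caratheodory_field
begin

abbreviation sol :: "real \<Rightarrow> 'a \<Rightarrow> real \<Rightarrow> 'a" where
  "sol s p \<equiv> ode_solution a b f s p"

text \<open>
  Solutions may start at different times \<open>s\<close> and \<open>s'\<close>; comparing them at \<open>s'\<close> yields continuity in
  the initial time without any group property of the flow.
\<close>

lemma sol_close:
  assumes "s \<in> {a..b}" "s' \<in> {a..b}" "t \<in> {a..b}"
  shows "norm (sol s' q t - sol s p t) \<le> exp (L * \<bar>t - s'\<bar>) * norm (q - sol s p s')"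
  using solutions_close[OF ode_solution(1)[OF assms(2), of q] ode_solution(1)[OF assms(1), of p] assms(2,3)]
  by (simp add: ode_solution(2)[OF assms(2)])

lemma sol_expansion:
  assumes "s \<in> {a..b}" "t \<in> {a..b}"
  shows "exp (- L * \<bar>t - s\<bar>) * norm (q - p) \<le> norm (sol s q t - sol s p t)"
proof -
  have "norm (sol s q s - sol s p s) \<le> exp (L * \<bar>s - t\<bar>) * norm (sol s q t - sol s p t)"
    by (rule solutions_close[OF ode_solution(1) ode_solution(1)]) (use assms in auto)
  then have "norm (q - p) \<le> exp (L * \<bar>t - s\<bar>) * norm (sol s q t - sol s p t)"
    using assms by (simp add: ode_solution(2) abs_minus_commute)
  then have "exp (- L * \<bar>t - s\<bar>) * norm (q - p)
      \<le> exp (- L * \<bar>t - s\<bar>) * (exp (L * \<bar>t - s\<bar>) * norm (sol s q t - sol s p t))"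
    by (intro mult_left_mono) auto
  then show ?thesis by (simp add: mult.assoc[symmetric] exp_add[symmetric])
qed

lemma continuous_on_sol: "s \<in> {a..b} \<Longrightarrow> continuous_on {a..b} (sol s p)"
  using ode_solution(1) by (simp add: integral_solution_def)

lemma continuous_on_sol_initial:
  assumes y: "continuous_on {a..b} y" and t: "t \<in> {a..b}"
  shows "continuous_on {a..b} (\<lambda>s. sol s (y s) t)"
  unfolding continuous_on_def
proof
  fix s assume s: "s \<in> {a..b}"
  let ?F = "at s within {a..b}"
  have "((\<lambda>r. y r - sol s (y s) r) \<longlongrightarrow> y s - sol s (y s) s) ?F"
    using y continuous_on_sol[OF s] s by (intro tendsto_diff) (auto simp: continuous_on_def)
  then have "((\<lambda>r. exp (L * (b - a)) * norm (y r - sol s (y s) r)) \<longlongrightarrow> exp (L * (b - a)) * norm (y s - sol s (y s) s)) ?F"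
    by (rule tendsto_mult_left[OF tendsto_norm])
  then have lim: "((\<lambda>r. exp (L * (b - a)) * norm (y r - sol s (y s) r)) \<longlongrightarrow> 0) ?F"
    using ode_solution(2)[OF s] by simp
  have "((\<lambda>r. sol r (y r) t - sol s (y s) t) \<longlongrightarrow> 0) ?F"
  proof (rule Lim_null_comparison[OF _ lim])
    have "norm (sol r (y r) t - sol s (y s) t) \<le> exp (L * (b - a)) * norm (y r - sol s (y s) r)"
      if r: "r \<in> {a..b}" for r
    proof -
      have "norm (sol r (y r) t - sol s (y s) t) \<le> exp (L * \<bar>t - r\<bar>) * norm (y r - sol s (y s) r)"
        by (rule sol_close[OF s r t])
      also have "\<dots> \<le> exp (L * (b - a)) * norm (y r - sol s (y s) r)"
        using L r t by (intro mult_right_mono) (auto intro!: mult_left_mono)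
      finally show ?thesis .
    qed
    then show "\<forall>\<^sub>F r in ?F. norm (sol r (y r) t - sol s (y s) t) \<le> exp (L * (b - a)) * norm (y r - sol s (y s) r)"
      unfolding eventually_at_filter by (simp add: always_eventually)
  qed
  then show "((\<lambda>s. sol s (y s) t) \<longlongrightarrow> sol s (y s) t) ?F"
    by (rule LIM_zero_cancel)
qed

end

section \<open>Differentiability of the flow\<close>

text \<open>
  The second derivative of the field enters only through the quadratic Taylor remainder.
\<close>

locale smooth_field = caratheodory_field +
  fixes Df :: "real \<Rightarrow> 'a \<Rightarrow> 'a \<Rightarrow> 'a" and L2 :: real
  assumes L2: "L2 \<ge> 0"
    and Df_linear: "\<And>t p. t \<in> {a<..<b} \<Longrightarrow> linear (Df t p)"
    and Df_bound: "\<And>t p v. t \<in> {a<..<b} \<Longrightarrow> norm (Df t p v) \<le> L * norm v"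
    and remainder: "\<And>t p v. t \<in> {a<..<b} \<Longrightarrow> norm (f t (p + v) - f t p - Df t p v) \<le> L2 * (norm v)\<^sup>2"
begin

text \<open>
  The linearisation along a curve is again a Caratheodory field; it is measurable in time as a
  pointwise limit of difference quotients of \<open>f\<close>.
\<close>

lemma variational_field:
  assumes x: "continuous_on {a..b} x"
  shows "caratheodory_field a b (\<lambda>t. Df t (x t)) L 0 E"
proof
  fix v
  have lim: "(\<lambda>n. real (Suc n) *\<^sub>R (f t (x t + (1 / Suc n) *\<^sub>R v) - f t (x t))) \<longlonglongrightarrow> Df t (x t) v"
    if "t \<in> {a<..<b}" for t
    using that remainder L2 Df_linear
    by (intro has_derivative_difference_quotients has_derivative_quadratic_remainder[where C = L2])
      (auto simp: linear_conv_bounded_linear)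
  show "(\<lambda>t. Df t (x t) v) \<in> borel_measurable (time_measure a b)"
  proof (rule borel_measurable_LIMSEQ_metric)
    fix n
    have "continuous_on {a..b} (\<lambda>t. x t + (1 / Suc n) *\<^sub>R v)"
      by (intro continuous_intros x)
    from measurable_along[OF this] measurable_along[OF x]
    show "(\<lambda>t. real (Suc n) *\<^sub>R (f t (x t + (1 / Suc n) *\<^sub>R v) - f t (x t))) \<in> borel_measurable (time_measure a b)"
      by (intro borel_measurable_scaleR borel_measurable_diff) auto
  next
    fix t assume "t \<in> space (time_measure a b)"
    then show "(\<lambda>n. real (Suc n) *\<^sub>R (f t (x t + (1 / Suc n) *\<^sub>R v) - f t (x t))) \<longlonglongrightarrow> Df t (x t) v"
      by (intro lim) simp
  qed
next
  fix t p q assume "t \<in> {a<..<b} - E"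
  then show "norm (Df t (x t) p - Df t (x t) q) \<le> L * norm (p - q)"
    using Df_bound[of t "x t" "p - q"] by (simp add: linear_diff[OF Df_linear])
next
  fix t assume "t \<in> {a<..<b} - E"
  then show "norm (Df t (x t) 0) \<le> 0" using Df_bound[of t "x t" 0] by simp
qed (use ab L E in auto)

text \<open>
  The derivative sends \<open>h\<close> to the solution \<open>v h\<close> of the variational equation with initial value
  \<open>h\<close>. The error of this linearisation solves the same equation with an inhomogeneity that is
  quadratic in \<open>h\<close>, so Gronwall's inequality keeps it quadratic.
\<close>

lemma flow_differentiable:
  assumes s: "s \<in> {a..b}" and t: "t \<in> {a..b}"
  shows "\<exists>D. ((\<lambda>q. sol s q t) has_derivative D) (at p)"
proof -
  let ?x = "sol s p"
  interpret V: caratheodory_field a b "\<lambda>t. Df t (?x t)" L 0 E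
    by (rule variational_field[OF continuous_on_sol[OF s]])
  define v where "v h = V.sol s h" for h
  have v: "V.integral_solution (v h)" "v h s = h" for h
    using V.ode_solution[OF s] by (simp_all add: v_def)
  have v_int: "((\<lambda>t. Df t (?x t) (v h t)) has_integral (v h t - v h r)) {r..t}"
    if "a \<le> r" "r \<le> t" "t \<le> b" for h r t
    using v(1) that by (auto simp: V.integral_solution_def)
  have v_cont: "continuous_on {a..b} (v h)" for h
    using v(1) by (auto simp: V.integral_solution_def)
  have unique: "v h t = y t" if "V.integral_solution y" "y s = h" for h y
    using V.solutions_close[OF v(1)[of h] that(1) s t] v(2) that(2) by simp
  have negl: "negligible (E \<union> {a,b})" by (rule negligible_exceptional)
  have "linear (\<lambda>h. v h t)"
  proof
    fix h k
    have "V.integral_solution (\<lambda>t. v h t + v k t)"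
      unfolding V.integral_solution_def
    proof (intro conjI allI impI continuous_on_add)
      fix r t assume rt: "a \<le> r" "r \<le> t" "t \<le> b"
      have "((\<lambda>t. Df t (?x t) (v h t + v k t)) has_integral ((v h t - v h r) + (v k t - v k r))) {r..t}"
        using rt by (intro has_integral_spike[OF negl _ has_integral_add[OF v_int[OF rt, of h] v_int[OF rt, of k]]])
          (auto simp: linear_add[OF Df_linear])
      then show "((\<lambda>t. Df t (?x t) (v h t + v k t)) has_integral (v h t + v k t - (v h r + v k r))) {r..t}"
        by (simp add: algebra_simps)
    qed (use v_cont ab in auto)
    then show "v (h + k) t = v h t + v k t"
      using v(2) by (intro unique) auto
  next
    fix c :: real and h
    have "V.integral_solution (\<lambda>t. c *\<^sub>R v h t)"
      unfolding V.integral_solution_def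
    proof (intro conjI allI impI continuous_on_scaleR continuous_on_const)
      fix r t assume rt: "a \<le> r" "r \<le> t" "t \<le> b"
      have "((\<lambda>t. Df t (?x t) (c *\<^sub>R v h t)) has_integral (c *\<^sub>R (v h t - v h r))) {r..t}"
        using rt by (intro has_integral_spike[OF negl _ has_integral_cmul[OF v_int[OF rt, of h], of c]])
          (auto simp: linear_scale[OF Df_linear])
      then show "((\<lambda>t. Df t (?x t) (c *\<^sub>R v h t)) has_integral (c *\<^sub>R v h t - c *\<^sub>R v h r)) {r..t}"
        by (simp add: algebra_simps)
    qed (use v_cont ab in auto)
    then show "v (c *\<^sub>R h) t = c *\<^sub>R v h t"
      using v(2) by (intro unique) auto
  qed
  then have lin: "bounded_linear (\<lambda>h. v h t)"
    by (simp add: linear_conv_bounded_linear)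
  define C where "C = exp (L * (b - a))"
  have "C \<ge> 1" using L ab by (simp add: C_def)
  have exp_le: "exp (L * \<bar>r - s\<bar>) \<le> C" if "r \<in> {a..b}" for r
    using that s L by (auto simp: C_def intro!: mult_left_mono)
  have main: "norm (sol s (p + h) t - ?x t - v h t) \<le> L2 * C\<^sup>2 * (b - a) * C * (norm h)\<^sup>2" for h
  proof -
    let ?y = "sol s (p + h)"
    let ?w = "\<lambda>t. ?y t - ?x t - v h t"
    let ?w' = "\<lambda>t. f t (?y t) - f t (?x t) - Df t (?x t) (v h t)"
    have yx: "norm (?y r - ?x r) \<le> C * norm h" if "r \<in> {a..b}" for r
    proof -
      have "norm (?y r - ?x r) \<le> exp (L * \<bar>r - s\<bar>) * norm h"
        using sol_close[OF s s that, of "p + h" p] by (simp add: ode_solution(2)[OF s])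
      also have "\<dots> \<le> C * norm h" using exp_le[OF that] by (intro mult_right_mono) auto
      finally show ?thesis .
    qed
    have "norm (?w t) \<le> (norm (?w s) + L2 * (C * norm h)\<^sup>2 * \<bar>t - s\<bar>) * exp (L * \<bar>t - s\<bar>)"
    proof (rule gronwall[where w = ?w and w' = ?w' and N = "E \<union> {a,b}"])
      fix r t assume rt: "a \<le> r" "r \<le> t" "t \<le> b"
      have "(?w' has_integral (?y t - ?y r - (?x t - ?x r) - (v h t - v h r))) {r..t}"
        using rt ode_solution(1)[OF s] v_int[OF rt] by (intro has_integral_diff) (auto simp: integral_solution_def)
      then show "(?w' has_integral (?w t - ?w r)) {r..t}"
        by (simp add: algebra_simps)
    next
      show "continuous_on {a..b} ?w"
        by (intro continuous_intros continuous_on_sol s v_cont)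
      fix r assume r: "r \<in> {a..b} - (E \<union> {a,b})"
      then have r': "r \<in> {a<..<b}" by auto
      have "Df r (?x r) (v h r) = Df r (?x r) (?y r - ?x r) - Df r (?x r) (?w r)"
        by (simp add: linear_diff[OF Df_linear[OF r']])
      then have w'_eq: "?w' r = (f r (?x r + (?y r - ?x r)) - f r (?x r) - Df r (?x r) (?y r - ?x r)) + Df r (?x r) (?w r)"
        by simp
      have "norm (?w' r) \<le> L2 * (norm (?y r - ?x r))\<^sup>2 + L * norm (?w r)"
        unfolding w'_eq by (intro norm_triangle_mono remainder Df_bound r')
      moreover have "(norm (?y r - ?x r))\<^sup>2 \<le> (C * norm h)\<^sup>2"
        using yx r by (intro power_mono) auto
      ultimately show "norm (?w' r) \<le> L * norm (?w r) + L2 * (C * norm h)\<^sup>2"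
        using mult_left_mono[OF _ L2] by fastforce
    qed (use negl L L2 s t in auto)
    also have "\<dots> = L2 * (C * norm h)\<^sup>2 * (\<bar>t - s\<bar> * exp (L * \<bar>t - s\<bar>))"
      by (simp add: ode_solution(2)[OF s] v(2))
    also have "\<dots> \<le> L2 * (C * norm h)\<^sup>2 * ((b - a) * C)"
      using s t exp_le[OF t] L2 by (intro mult_left_mono mult_mono) auto
    finally show ?thesis by (simp add: power_mult_distrib mult_ac)
  qed
  have "((\<lambda>q. sol s q t) has_derivative (\<lambda>h. v h t)) (at p)"
    by (rule has_derivative_quadratic_remainder[OF lin _ main])
      (use L2 \<open>C \<ge> 1\<close> ab in auto)
  then show ?thesis by blast
qed

end

text \<open>
  Two-sided Lipschitz bounds pass to the derivative through difference quotients.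
\<close>

lemma has_derivative_bounds:
  assumes g: "(g has_derivative D) (at p)"
    and lower: "\<And>q. c * norm (q - p) \<le> norm (g q - g p)"
    and upper: "\<And>q. norm (g q - g p) \<le> C * norm (q - p)"
  shows "c * norm h \<le> norm (D h)" "norm (D h) \<le> C * norm h"
proof -
  have lim: "(\<lambda>n. norm (real (Suc n) *\<^sub>R (g (p + (1 / Suc n) *\<^sub>R h) - g p))) \<longlonglongrightarrow> norm (D h)"
    by (intro tendsto_norm has_derivative_difference_quotients g)
  have "c * norm h \<le> norm (real (Suc n) *\<^sub>R (g (p + (1 / Suc n) *\<^sub>R h) - g p))" 
    "norm (real (Suc n) *\<^sub>R (g (p + (1 / Suc n) *\<^sub>R h) - g p)) \<le> C * norm h" for n
  proof -
    have "real (Suc n) * (c * norm ((1 / Suc n) *\<^sub>R h)) \<le> real (Suc n) * norm (g (p + (1 / Suc n) *\<^sub>R h) - g p)"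
      using lower[of "p + (1 / Suc n) *\<^sub>R h"] by (intro mult_left_mono) simp_all
    then show "c * norm h \<le> norm (real (Suc n) *\<^sub>R (g (p + (1 / Suc n) *\<^sub>R h) - g p))"
      by (simp only: norm_scaleR) simp
    have "real (Suc n) * norm (g (p + (1 / Suc n) *\<^sub>R h) - g p) \<le> real (Suc n) * (C * norm ((1 / Suc n) *\<^sub>R h))"
      using upper[of "p + (1 / Suc n) *\<^sub>R h"] by (intro mult_left_mono) simp_all
    then show "norm (real (Suc n) *\<^sub>R (g (p + (1 / Suc n) *\<^sub>R h) - g p)) \<le> C * norm h"
      by (simp only: norm_scaleR) simp
  qed
  then show "c * norm h \<le> norm (D h)" "norm (D h) \<le> C * norm h"
    using LIMSEQ_le_const[OF lim] LIMSEQ_le_const2[OF lim] by blast+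
qed

locale smooth_field_vec = smooth_field a b f L M E Df L2
  for a b :: real and f :: "real \<Rightarrow> real^'d \<Rightarrow> real^'d" and L M E Df L2
begin

lemma flow_eq_sol: "flow a b f s t = (\<lambda>q. sol s q t)"
  by (simp add: flow_def fun_eq_iff)

lemma D_flow:
  assumes "s \<in> {a..b}" "t \<in> {a..b}"
  shows "((\<lambda>q. sol s q t) has_derivative (*v) (D_flow a b f s t p)) (at p)"
proof -
  have "(\<lambda>q. sol s q t) differentiable at p"
    using flow_differentiable[OF assms] by (simp add: differentiable_def)
  then show ?thesis by (simp add: D_flow_def flow_eq_sol jacobian_works)
qed

lemma D_flow_bounds:
  assumes "s \<in> {a..b}" "t \<in> {a..b}"
  shows "exp (- L * (b - a)) * norm h \<le> norm (D_flow a b f s t p *v h)"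
    and "norm (D_flow a b f s t p *v h) \<le> exp (L * (b - a)) * norm h"
proof -
  have le: "L * \<bar>t - s\<bar> \<le> L * (b - a)" using assms L by (intro mult_left_mono) auto
  have "exp (- L * (b - a)) * norm (q - p) \<le> norm (sol s q t - sol s p t)" for q
    using sol_expansion[OF assms, of q p] le
    by - (erule order_trans[rotated], intro mult_right_mono, simp_all)
  moreover have "norm (sol s q t - sol s p t) \<le> exp (L * (b - a)) * norm (q - p)" for q
    using sol_close[OF assms(1,1,2), of q p] le unfolding ode_solution(2)[OF assms(1)]
    by - (erule order_trans, intro mult_right_mono, simp_all)
  ultimately show "exp (- L * (b - a)) * norm h \<le> norm (D_flow a b f s t p *v h)"
    "norm (D_flow a b f s t p *v h) \<le> exp (L * (b - a)) * norm h"
    by (rule has_derivative_bounds[OF D_flow[OF assms]])+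
qed

text \<open>
  The columns of the Jacobian are limits of difference quotients of the flow along the coordinate
  directions, and these quotients depend continuously on the initial time.
\<close>

lemma measurable_D_flow:
  assumes x: "continuous_on {a..b} x" and t: "t \<in> {a..b}"
  shows "(\<lambda>s. D_flow a b f s t (x s)) \<in> borel_measurable (time_measure a b)"
proof (rule borel_measurable_LIMSEQ_metric)
  define G :: "nat \<Rightarrow> real \<Rightarrow> real^'d^'d" where "G n s = (\<chi> i j. (real (Suc n) *\<^sub>R
      (sol s (x s + (1 / Suc n) *\<^sub>R axis j 1) t - sol s (x s) t)) $ i)" for n s
  show "G n \<in> borel_measurable (time_measure a b)" for n
  proof (rule continuous_imp_measurable_on_sets_lebesgue)
    have "continuous_on {a..b} (G n)"
      unfolding G_def
      by (intro continuous_on_vec_lambda continuous_on_component continuous_on_scaleR continuous_on_const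
          continuous_on_diff continuous_on_sol_initial x t continuous_on_add)
    then show "continuous_on {a<..<b} (G n)"
      by (rule continuous_on_subset) auto
  qed simp
  fix s assume "s \<in> space (time_measure a b)"
  then have s: "s \<in> {a..b}" by simp
  have "D_flow a b f s t (x s) = (\<chi> i j. (D_flow a b f s t (x s) *v axis j 1) $ i)"
    by (simp add: vec_eq_iff matrix_vector_mul_component inner_axis)
  moreover have "(\<lambda>n. G n s) \<longlonglongrightarrow> (\<chi> i j. (D_flow a b f s t (x s) *v axis j 1) $ i)"
    unfolding G_def
    by (intro tendsto_vec_lambda tendsto_vec_nth has_derivative_difference_quotients D_flow s t)
  ultimately show "(\<lambda>n. G n s) \<longlonglongrightarrow> D_flow a b f s t (x s)" by simp
qed

end

lemma admissible_drift_smooth_field: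
  fixes N :: "real \<Rightarrow> real^'d \<Rightarrow> real^'d"
  assumes "t0 < T" "\<Lambda>1 > 0" "\<Lambda>2 > 0" and adm: "admissible_drift t0 T N \<Lambda>1 \<Lambda>2"
  obtains M E Df where "smooth_field_vec t0 T N \<Lambda>1 M E Df \<Lambda>2"
proof -
  obtain DN :: "real \<Rightarrow> real^'d \<Rightarrow> ((real^'d) \<Rightarrow>\<^sub>L (real^'d))"
    and D2N :: "real \<Rightarrow> real^'d \<Rightarrow> ((real^'d) \<Rightarrow>\<^sub>L ((real^'d) \<Rightarrow>\<^sub>L (real^'d)))"
    where DN: "\<And>t x. t \<in> {t0..T} \<Longrightarrow> (N t has_derivative blinfun_apply (DN t x)) (at x)"
      and D2N: "\<And>t x. t \<in> {t0..T} \<Longrightarrow> (DN t has_derivative blinfun_apply (D2N t x)) (at x)"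
      and DN_le: "\<And>t x. t \<in> {t0..T} \<Longrightarrow> norm (DN t x) \<le> \<Lambda>1"
      and D2N_le: "\<And>t x. t \<in> {t0..T} \<Longrightarrow> norm (D2N t x) \<le> \<Lambda>2"
  proof -
    from adm obtain DN D2N where "\<forall>t\<in>{t0..T}. continuous_on UNIV (D2N t) \<and>
        (\<forall>x. (N t has_derivative blinfun_apply (DN t x)) (at x) \<and>
             (DN t has_derivative blinfun_apply (D2N t x)) (at x) \<and>
             norm (DN t x) \<le> \<Lambda>1 \<and> norm (D2N t x) \<le> \<Lambda>2)"
      unfolding admissible_drift_def by (elim conjE exE)
    then show thesis by (intro that[of DN D2N]) simp_all
  qed
  have meas: "(\<lambda>t. N t p) \<in> borel_measurable (time_measure t0 T)" for p
    using adm by (auto simp: admissible_drift_def Linfty_def)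
  obtain C where C: "AE t in time_measure t0 T. norm (N t 0) \<le> C"
    using adm unfolding admissible_drift_def Linfty_def by blast
  define E where "E = {t \<in> {t0<..<T}. \<not> norm (N t 0) \<le> C}"
  have E: "negligible E"
    using C unfolding E_def by (simp add: AE_lebesgue_on_iff_negligible)
  have lipN: "norm (N t p - N t q) \<le> \<Lambda>1 * norm (p - q)" if t: "t \<in> {t0..T}" for t p q
  proof (rule differentiable_bound[of UNIV])
    show "onorm (blinfun_apply (DN t x)) \<le> \<Lambda>1" for x
      using DN_le[OF t, of x] by (simp add: norm_blinfun.rep_eq)
  qed (use DN[OF t] in auto)
  have lipDN: "norm (DN t p - DN t q) \<le> \<Lambda>2 * norm (p - q)" if t: "t \<in> {t0..T}" for t p q
  proof (rule differentiable_bound[of UNIV])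
    show "onorm (blinfun_apply (D2N t x)) \<le> \<Lambda>2" for x
      using D2N_le[OF t, of x] by (simp add: norm_blinfun.rep_eq)
  qed (use D2N[OF t] in auto)
  have remainder: "norm (N t (p + v) - N t p - DN t p v) \<le> \<Lambda>2 * (norm v)\<^sup>2" if t: "t \<in> {t0..T}" for t p v
  proof -
    let ?S = "cball p (norm v)"
    have "norm ((N t (p + v) - DN t p (p + v)) - (N t p - DN t p p)) \<le> \<Lambda>2 * norm v * norm (p + v - p)"
    proof (rule differentiable_bound[of ?S])
      show "((\<lambda>y. N t y - DN t p y) has_derivative blinfun_apply (DN t x - DN t p)) (at x within ?S)" for x
        by (auto intro!: derivative_eq_intros has_derivative_at_withinI[OF DN[OF t]]
            simp: blinfun.diff_left)
      show "onorm (blinfun_apply (DN t x - DN t p)) \<le> \<Lambda>2 * norm v" if "x \<in> ?S" for x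
      proof -
        have "norm (DN t x - DN t p) \<le> \<Lambda>2 * norm (x - p)" by (rule lipDN[OF t])
        also have "\<dots> \<le> \<Lambda>2 * norm v"
          using that \<open>\<Lambda>2 > 0\<close> by (intro mult_left_mono) (auto simp: dist_norm norm_minus_commute)
        finally show ?thesis by (simp add: norm_blinfun.rep_eq)
      qed
    qed (auto simp: dist_norm)
    then show ?thesis by (simp add: blinfun.add_right power2_eq_square algebra_simps)
  qed
  have "smooth_field_vec t0 T N \<Lambda>1 (max C 0) E (\<lambda>t p. blinfun_apply (DN t p)) \<Lambda>2"
  proof (intro smooth_field_vec.intro smooth_field.intro caratheodory_field.intro smooth_field_axioms.intro)
    fix t p v assume t: "t \<in> {t0<..<T}"
    show "linear (blinfun_apply (DN t p))"
      using blinfun.bounded_linear_right by (simp add: linear_conv_bounded_linear)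
    show "norm (blinfun_apply (DN t p) v) \<le> \<Lambda>1 * norm v"
      using norm_blinfun[of "DN t p" v] mult_right_mono[OF DN_le[of t p], of "norm v"] t by auto
    show "norm (N t (p + v) - N t p - blinfun_apply (DN t p) v) \<le> \<Lambda>2 * (norm v)\<^sup>2"
      using t by (intro remainder) auto
  next
    fix t assume "t \<in> {t0<..<T} - E"
    then show "norm (N t 0) \<le> max C 0" by (auto simp: E_def)
  qed (use assms E meas lipN in auto)
  then show thesis by (rule that)
qed

section \<open>Symmetric matrices\<close>

text \<open>
  A minimiser \<open>v\<close> of the quadratic form on the unit sphere is an eigenvector: if the residual
  \<open>r = A v - l v\<close> were nonzero, moving from \<open>v\<close> a little way along \<open>- r\<close> would decrease the
  nonnegative form \<open>w\<^sup>T A w - l \<bar>w\<bar>\<^sup>2\<close> below its value \<open>0\<close> at \<open>v\<close>.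
\<close>

lemma symmetric_matrix_eigenvalue:
  fixes A :: "real^'n^'n"
  assumes sym: "transpose A = A"
  shows "\<exists>l v. v \<noteq> 0 \<and> A *v v = l *\<^sub>R v"
proof -
  have symD: "x \<bullet> (A *v y) = (A *v x) \<bullet> y" for x y
    using dot_lmul_matrix[of x A y] transpose_matrix_vector[of A x] sym by simp
  have "\<exists>v\<in>sphere 0 1. \<forall>w\<in>sphere 0 1. v \<bullet> (A *v v) \<le> w \<bullet> (A *v w)"
  proof (rule continuous_attains_inf)
    show "sphere 0 1 \<noteq> ({} :: (real^'n) set)" by simp
    show "continuous_on (sphere 0 1) (\<lambda>v. v \<bullet> (A *v v))"
      by (intro continuous_intros)
  qed simp
  then obtain v where v: "norm v = 1" and min: "\<And>w. norm w = 1 \<Longrightarrow> v \<bullet> (A *v v) \<le> w \<bullet> (A *v w)"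
    by auto
  define l where "l = v \<bullet> (A *v v)"
  define Q where "Q w = w \<bullet> (A *v w) - l * (w \<bullet> w)" for w
  have Q: "Q w \<ge> 0" for w
  proof (cases "w = 0")
    case False
    have "l \<le> (w /\<^sub>R norm w) \<bullet> (A *v (w /\<^sub>R norm w))"
      unfolding l_def using False by (intro min) simp
    also have "\<dots> = (w \<bullet> (A *v w)) / (norm w)\<^sup>2"
      by (simp add: matrix_vector_mult_scaleR power2_eq_square field_simps)
    finally show ?thesis
      using False by (simp add: Q_def power2_norm_eq_inner[symmetric] pos_le_divide_eq)
  qed (simp add: Q_def)
  define r where "r = A *v v - l *\<^sub>R v"
  have v1: "v \<bullet> v = 1" using v by (simp add: norm_eq_1)
  have expand: "Q (v + s *\<^sub>R r) = 2 * s * (r \<bullet> r) + s\<^sup>2 * Q r" for s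
  proof -
    have rr: "r \<bullet> r = r \<bullet> (A *v v) - l * (r \<bullet> v)"
      unfolding r_def by (simp only: inner_diff_right inner_scaleR_right)
    have vr: "v \<bullet> (A *v r) = r \<bullet> (A *v v)" using symD[of v r] inner_commute[of "A *v v" r] by simp
    have "(v + s *\<^sub>R r) \<bullet> (A *v (v + s *\<^sub>R r)) = v \<bullet> (A *v v) + s * (v \<bullet> (A *v r)) + s * (r \<bullet> (A *v v)) + s\<^sup>2 * (r \<bullet> (A *v r))"
      unfolding matrix_vector_right_distrib matrix_vector_mult_scaleR inner_add_left inner_add_right
      by (simp add: power2_eq_square)
    then have e1: "(v + s *\<^sub>R r) \<bullet> (A *v (v + s *\<^sub>R r)) = l + 2 * s * (r \<bullet> (A *v v)) + s\<^sup>2 * (r \<bullet> (A *v r))"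
      unfolding vr l_def by simp
    have e2: "(v + s *\<^sub>R r) \<bullet> (v + s *\<^sub>R r) = 1 + 2 * s * (r \<bullet> v) + s\<^sup>2 * (r \<bullet> r)"
      using v1 by (simp add: inner_add_left inner_add_right power2_eq_square inner_commute[of v r] distrib_left)
    show ?thesis
      unfolding Q_def e1 e2 by (subst (2) rr) (simp add: algebra_simps)
  qed
  \<comment> \<open>This step length makes the value negative unless the residual \<open>r\<close> vanishes.\<close>
  define s where "s = - (r \<bullet> r) / (Q r + 1)"
  have "r \<bullet> r = 0"
  proof -
    have pos: "Q r + 1 > 0" using Q[of r] by simp
    have s: "s * (Q r + 1) = - (r \<bullet> r)" using pos by (simp add: s_def)
    have "0 \<le> (2 * s * (r \<bullet> r) + s\<^sup>2 * Q r) * (Q r + 1)"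
      using Q[of "v + s *\<^sub>R r"] pos unfolding expand by simp
    also have "\<dots> = (s * (Q r + 1)) * (2 * (r \<bullet> r) + s * Q r)"
      by (simp add: power2_eq_square algebra_simps)
    also have "\<dots> = - (r \<bullet> r) * ((r \<bullet> r) - s)"
    proof -
      have sQ: "s * Q r = - (r \<bullet> r) - s" using s by (simp add: algebra_simps)
      show ?thesis unfolding s sQ by (simp add: algebra_simps)
    qed
    finally have "(r \<bullet> r) * (r \<bullet> r) \<le> (r \<bullet> r) * s" by (simp add: algebra_simps)
    also have "\<dots> \<le> 0"
      using pos by (intro mult_nonneg_nonpos) (auto simp: s_def divide_nonpos_pos)
    finally show ?thesis
      using mult_le_0_iff[of "r \<bullet> r" "r \<bullet> r"] inner_ge_zero[of r] by linarith
  qed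
  then have "A *v v = l *\<^sub>R v" by (simp add: r_def)
  then show ?thesis using v by (intro exI[of _ l] exI[of _ v]) auto
qed

text \<open>
  Eigenvectors for distinct eigenvalues are orthogonal, hence linearly independent. Finiteness
  matters because \<open>lambda_min\<close> is a \<open>Min\<close>, which has no meaning on infinite sets.
\<close>

lemma symmetric_matrix_finite_eigenvalues:
  fixes A :: "real^'n^'n"
  assumes sym: "transpose A = A"
  shows "finite {l. \<exists>v. v \<noteq> 0 \<and> A *v v = l *\<^sub>R v}" (is "finite ?S")
proof -
  have symD: "x \<bullet> (A *v y) = (A *v x) \<bullet> y" for x y
    using dot_lmul_matrix[of x A y] transpose_matrix_vector[of A x] sym by simp
  have "\<forall>l\<in>?S. \<exists>v. v \<noteq> 0 \<and> A *v v = l *\<^sub>R v" by blast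
  then obtain e where e: "\<And>l. l \<in> ?S \<Longrightarrow> e l \<noteq> 0 \<and> A *v e l = l *\<^sub>R e l"
    by (metis (no_types, lifting) bchoice)
  have orth: "e l \<bullet> e m = 0" if "l \<in> ?S" "m \<in> ?S" "l \<noteq> m" for l m
  proof -
    have "m * (e l \<bullet> e m) = l * (e l \<bullet> e m)"
      using symD[of "e l" "e m"] e[OF that(1)] e[OF that(2)] by simp
    then show ?thesis using that by simp
  qed
  have inj: "inj_on e ?S"
  proof (rule inj_onI, rule ccontr)
    fix l m assume "l \<in> ?S" "m \<in> ?S" "e l = e m" "l \<noteq> m"
    then show False using orth[of l m] e[of l] by simp
  qed
  have "independent (e ` ?S)"
  proof (rule pairwise_orthogonal_independent)
    show "pairwise orthogonal (e ` ?S)"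
      unfolding pairwise_def orthogonal_def using orth by blast
    show "0 \<notin> e ` ?S" using e by force
  qed
  then have "finite (e ` ?S)" by (rule finiteI_independent)
  then show ?thesis using inj by (rule finite_imageD)
qed

lemma lambda_min_ge:
  fixes A :: "real^'n^'n"
  assumes sym: "transpose A = A" and le: "\<And>v. c * (norm v)\<^sup>2 \<le> v \<bullet> (A *v v)"
  shows "c \<le> lambda_min A"
  unfolding lambda_min_def
proof (rule Min.boundedI)
  show "{l. \<exists>v. v \<noteq> 0 \<and> A *v v = l *\<^sub>R v} \<noteq> {}"
    using symmetric_matrix_eigenvalue[OF sym] by blast
  fix l assume "l \<in> {l. \<exists>v. v \<noteq> 0 \<and> A *v v = l *\<^sub>R v}"
  then obtain v where v: "v \<noteq> 0" "A *v v = l *\<^sub>R v" by blast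
  then have "c * (norm v)\<^sup>2 \<le> l * (norm v)\<^sup>2"
    using le[of v] by (simp add: power2_norm_eq_inner)
  then show "c \<le> l" using v by simp
qed (rule symmetric_matrix_finite_eigenvalues[OF sym])

text \<open>
  A square matrix with \<open>\<bar>A h\<bar> \<ge> c \<bar>h\<bar>\<close> is invertible with inverse of norm at most \<open>1 / c\<close>, and the
  transposed inverse has the same norm. The proof evaluates \<open>y \<bullet> y\<close> at \<open>y = A h\<close>.
\<close>

lemma transpose_expansion:
  fixes A :: "real^'n^'n"
  assumes "c > 0" and le: "\<And>h. c * norm h \<le> norm (A *v h)"
  shows "c * norm y \<le> norm (transpose A *v y)"
proof -
  have "inj ((*v) A)"
  proof (rule injI)
    fix x z assume "A *v x = A *v z"
    then have "A *v (x - z) = 0" by (simp add: matrix_vector_mult_diff_distrib)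
    then show "x = z" using le[of "x - z"] \<open>c > 0\<close> by (simp add: mult_le_0_iff)
  qed
  then have "surj ((*v) A)"
    by (intro linear_injective_imp_surjective) auto
  then obtain h where h: "y = A *v h" by (metis surjD)
  have "c * norm y * norm y = c * (y \<bullet> (A *v h))"
    using h by (simp add: power2_norm_eq_inner[symmetric] power2_eq_square)
  also have "\<dots> = c * ((transpose A *v y) \<bullet> h)"
    using dot_lmul_matrix[of y A h] by simp
  also have "\<dots> \<le> c * (norm (transpose A *v y) * norm h)"
    using \<open>c > 0\<close> by (intro mult_left_mono norm_cauchy_schwarz) auto
  also have "\<dots> \<le> norm (transpose A *v y) * norm y"
    using mult_left_mono[OF le[of h] norm_ge_zero[of "transpose A *v y"]] h by (simp add: mult_ac)
  finally show ?thesis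
    by (cases "y = 0") (auto simp: mult_le_cancel_right)
qed

section \<open>Matrix-valued functions\<close>

lemma bounded_bilinear_matrix_mult:
  "bounded_bilinear ((**) :: real^'n^'m \<Rightarrow> real^'p^'n \<Rightarrow> real^'p^'m)"
proof -
  have "(A + A') ** B = A ** B + A' ** B" for A A' :: "real^'n^'m" and B :: "real^'p^'n"
    by (simp add: matrix_matrix_mult_def vec_eq_iff sum.distrib distrib_right)
  then show ?thesis
    unfolding bilinear_conv_bounded_bilinear[symmetric] bilinear_def
    by (auto intro!: linearI simp: matrix_add_ldistrib scalar_matrix_assoc matrix_scalar_ac)
qed

lemma bounded_bilinear_matrix_vector_mult:
  "bounded_bilinear ((*v) :: real^'n^'m \<Rightarrow> real^'n \<Rightarrow> real^'m)"
  unfolding bilinear_conv_bounded_bilinear[symmetric] bilinear_def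
  by (auto intro!: linearI simp: matrix_vector_mult_add_rdistrib matrix_vector_right_distrib
      scaleR_matrix_vector_assoc[symmetric] matrix_vector_mult_scaleR)

lemma bounded_linear_transpose: "bounded_linear (transpose :: real^'n^'m \<Rightarrow> real^'m^'n)"
  unfolding linear_conv_bounded_linear[symmetric]
  by (auto intro!: linearI simp: transpose_def vec_eq_iff)

lemma borel_measurable_bilinear:
  fixes f :: "'a \<Rightarrow> 'b::euclidean_space" and g :: "'a \<Rightarrow> 'c::euclidean_space"
  assumes "bounded_bilinear h" "f \<in> borel_measurable M" "g \<in> borel_measurable M"
  shows "(\<lambda>t. h (f t) (g t)) \<in> borel_measurable M"
  by (rule borel_measurable_continuous_Pair[OF assms(2,3)])
    (rule bounded_bilinear.continuous_on[OF assms(1) continuous_on_fst continuous_on_snd];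
      rule continuous_on_id)

text \<open>
  The norm of the type \<open>real^'n^'m\<close> is not the operator norm; the crude comparison with a
  dimensional factor is enough for boundedness.
\<close>

lemma norm_matrix_le:
  fixes A :: "real^'n^'m" and C :: real
  assumes "\<And>h. norm (A *v h) \<le> C * norm h"
  shows "norm A \<le> CARD('m) * (CARD('n) * C)"
proof -
  have "\<bar>A $ i $ j\<bar> \<le> C" for i j
  proof -
    have "A $ i $ j = (A *v axis j 1) $ i"
      by (simp add: matrix_vector_mul_component inner_axis)
    then show ?thesis
      using component_le_norm_cart[of "A *v axis j 1" i] assms[of "axis j 1"] by (simp add: norm_axis_1)
  qed
  then have "norm (A $ i) \<le> (\<Sum>j\<in>(UNIV::'n set). C)" for i
    by (intro order_trans[OF norm_le_l1_cart] sum_mono)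
  moreover have "norm A \<le> (\<Sum>i\<in>UNIV. norm (A $ i))"
    by (simp add: norm_vec_def L2_set_le_sum)
  ultimately have "norm A \<le> (\<Sum>i\<in>(UNIV::'m set). (\<Sum>j\<in>(UNIV::'n set). C))"
    by (meson order_trans sum_mono)
  then show ?thesis by simp
qed

section \<open>Gramians\<close>

text \<open>
  The Cauchy-Schwarz inequality against the constant \<open>1\<close>, from the nonnegative variance of \<open>g\<close>.
\<close>

lemma (in finite_measure) square_integral_le:
  fixes g :: "'a \<Rightarrow> real"
  assumes g: "integrable M g" and g2: "integrable M (\<lambda>t. (g t)\<^sup>2)" and pos: "measure M (space M) > 0"
  shows "(\<integral>t. g t \<partial>M)\<^sup>2 / measure M (space M) \<le> (\<integral>t. (g t)\<^sup>2 \<partial>M)"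
proof -
  define \<mu> where "\<mu> = measure M (space M)"
  define I where "I = (\<integral>t. g t \<partial>M)"
  define m where "m = I / \<mu>"
  have "0 \<le> (\<integral>t. (g t - m)\<^sup>2 \<partial>M)" by simp
  also have "\<dots> = (\<integral>t. (g t)\<^sup>2 - 2 * m * g t + m\<^sup>2 \<partial>M)"
    by (simp add: power2_diff mult_ac add_diff_eq diff_add_eq)
  also have "\<dots> = (\<integral>t. (g t)\<^sup>2 \<partial>M) - 2 * m * I + m\<^sup>2 * \<mu>"
    using g g2 by (simp add: I_def \<mu>_def mult.commute)
  also have "\<dots> = (\<integral>t. (g t)\<^sup>2 \<partial>M) - I\<^sup>2 / \<mu>"
    using pos by (simp add: m_def \<mu>_def power2_eq_square field_simps)
  finally show ?thesis by (simp add: I_def \<mu>_def)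
qed

lemma (in finite_measure)
  fixes W :: "'a \<Rightarrow> real^'k^'d"
  assumes W: "W \<in> borel_measurable M" and bnd: "AE t in M. norm (W t) \<le> C"
  defines "G \<equiv> \<integral>t. W t ** transpose (W t) \<partial>M"
  shows gram_quadratic_form: "y \<bullet> (G *v y) = (\<integral>t. (norm (transpose (W t) *v y))\<^sup>2 \<partial>M)"
    and gram_symmetric: "transpose G = G"
    and gram_integrable: "integrable M (\<lambda>t. (norm (transpose (W t) *v y))\<^sup>2)"
      "integrable M (\<lambda>t. norm (transpose (W t) *v y))"
proof -
  obtain K where K: "\<And>A B. norm ((A :: real^'k^'d) ** (B :: real^'d^'k)) \<le> norm A * norm B * K" "K > 0"
    using bounded_bilinear.pos_bounded[OF bounded_bilinear_matrix_mult] by blast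
  obtain K' where K': "\<And>A :: real^'k^'d. norm (transpose A) \<le> norm A * K'" "K' > 0"
    using bounded_linear.pos_bounded[OF bounded_linear_transpose] by blast
  obtain K'' where K'': "\<And>(A :: real^'d^'k) v. norm (A *v v) \<le> norm A * norm v * K''" "K'' > 0"
    using bounded_bilinear.pos_bounded[OF bounded_bilinear_matrix_vector_mult] by blast
  have WT: "(\<lambda>t. transpose (W t)) \<in> borel_measurable M"
    using W by (rule borel_measurable_continuous_on[OF linear_continuous_on[OF bounded_linear_transpose]])
  have WTy: "(\<lambda>t. transpose (W t) *v y) \<in> borel_measurable M"
    by (rule borel_measurable_bilinear[OF bounded_bilinear_matrix_vector_mult WT]) simp
  have WTb: "norm (transpose (W t)) \<le> C * K'" if "norm (W t) \<le> C" for t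
    using K'(1)[of "W t"] that K'(2) by (meson mult_right_mono less_imp_le order_trans)
  have WTyb: "norm (transpose (W t) *v y) \<le> C * K' * norm y * K''" if "norm (W t) \<le> C" for t
    using WTb[OF that] K''(2)
    by (intro order_trans[OF K''(1)] mult_right_mono) auto
  show i1: "integrable M (\<lambda>t. norm (transpose (W t) *v y))"
  proof (rule integrable_const_bound)
    show "AE t in M. norm (norm (transpose (W t) *v y)) \<le> C * K' * norm y * K''"
      using bnd by eventually_elim (simp add: WTyb del: transpose_matrix_vector)
  qed (rule measurable_compose[OF WTy borel_measurable_norm])
  show i2: "integrable M (\<lambda>t. (norm (transpose (W t) *v y))\<^sup>2)"
  proof (rule integrable_const_bound)
    show "AE t in M. norm ((norm (transpose (W t) *v y))\<^sup>2) \<le> (C * K' * norm y * K'')\<^sup>2"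
      using bnd
    proof eventually_elim
      fix t assume "norm (W t) \<le> C"
      from power_mono[OF WTyb[OF this] norm_ge_zero, of 2]
      show "norm ((norm (transpose (W t) *v y))\<^sup>2) \<le> (C * K' * norm y * K'')\<^sup>2" by simp
    qed
  qed (intro borel_measurable_power measurable_compose[OF WTy borel_measurable_norm])
  have int: "integrable M (\<lambda>t. W t ** transpose (W t))"
  proof (rule integrable_const_bound)
    show "AE t in M. norm (W t ** transpose (W t)) \<le> C * (C * K') * K"
      using bnd
    proof eventually_elim
      fix t assume t: "norm (W t) \<le> C"
      then have "C \<ge> 0" using norm_ge_zero order_trans by blast
      then show "norm (W t ** transpose (W t)) \<le> C * (C * K') * K"
        using WTb[OF t] t K(2) by (intro order_trans[OF K(1)] mult_right_mono mult_mono) auto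
    qed
  qed (rule borel_measurable_bilinear[OF bounded_bilinear_matrix_mult W WT])
  have lin: "bounded_linear (\<lambda>A :: real^'d^'d. y \<bullet> (A *v y))"
    by (intro bounded_linear_inner_right_comp
        bounded_bilinear.bounded_linear_left[OF bounded_bilinear_matrix_vector_mult])
  have "y \<bullet> (G *v y) = (\<integral>t. y \<bullet> ((W t ** transpose (W t)) *v y) \<partial>M)"
    unfolding G_def by (rule integral_bounded_linear[OF lin int, symmetric])
  also have "\<dots> = (\<integral>t. (norm (transpose (W t) *v y))\<^sup>2 \<partial>M)"
    by (intro Bochner_Integration.integral_cong)
      (simp_all add: power2_norm_eq_inner dot_lmul_matrix[symmetric] flip: matrix_vector_mul_assoc)
  finally show "y \<bullet> (G *v y) = (\<integral>t. (norm (transpose (W t) *v y))\<^sup>2 \<partial>M)" .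
  show "transpose G = G"
  proof -
    have "transpose G = (\<integral>t. transpose (W t ** transpose (W t)) \<partial>M)"
      unfolding G_def by (rule integral_bounded_linear[OF bounded_linear_transpose int, symmetric])
    then show ?thesis by (simp add: G_def matrix_transpose_mul)
  qed
qed

text \<open>
  Applying the Cauchy-Schwarz inequality to \<open>\<bar>W\<^sup>T y\<bar>\<close>, which is bounded, rather than to \<open>\<beta>\<close> avoids
  the question whether \<open>\<beta>\<close> is square integrable.
\<close>

lemma (in finite_measure) gram_coercive:
  fixes W :: "'a \<Rightarrow> real^'k^'d"
  assumes W: "W \<in> borel_measurable M" and bnd: "AE t in M. norm (W t) \<le> C"
    and \<beta>: "integrable M \<beta>" "AE t in M. 0 \<le> \<beta> t"
    and lower: "AE t in M. \<forall>y. \<beta> t * norm y \<le> norm (transpose (W t) *v y)"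
    and pos: "measure M (space M) > 0"
  shows "(\<integral>t. \<beta> t \<partial>M)\<^sup>2 / measure M (space M) * (norm y)\<^sup>2
    \<le> y \<bullet> ((\<integral>t. W t ** transpose (W t) \<partial>M) *v y)"
proof -
  let ?g = "\<lambda>t. norm (transpose (W t) *v y)"
  have "(\<integral>t. \<beta> t \<partial>M) * norm y = (\<integral>t. \<beta> t * norm y \<partial>M)" by simp
  also have "\<dots> \<le> (\<integral>t. ?g t \<partial>M)"
    using lower by (intro integral_mono_AE gram_integrable[OF W bnd] integrable_mult_left \<beta>) auto
  finally have le: "(\<integral>t. \<beta> t \<partial>M) * norm y \<le> (\<integral>t. ?g t \<partial>M)" .
  have "0 \<le> (\<integral>t. \<beta> t \<partial>M)" using \<beta> by (intro integral_nonneg_AE)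
  then have "((\<integral>t. \<beta> t \<partial>M) * norm y)\<^sup>2 \<le> (\<integral>t. ?g t \<partial>M)\<^sup>2"
    using le by (intro power_mono) auto
  then have "((\<integral>t. \<beta> t \<partial>M) * norm y)\<^sup>2 / measure M (space M) \<le> (\<integral>t. ?g t \<partial>M)\<^sup>2 / measure M (space M)"
    using pos by (intro divide_right_mono) auto
  also have "\<dots> \<le> (\<integral>t. (?g t)\<^sup>2 \<partial>M)"
    by (rule square_integral_le[OF gram_integrable(2,1)[OF W bnd] pos])
  finally show ?thesis
    by (simp add: gram_quadratic_form[OF W bnd] power_mult_distrib)
qed

section \<open>Measurable sections\<close>

lemma negligible_Compl_imp_dense:
  fixes A :: "'a::euclidean_space set"
  assumes "negligible (- A)"
  shows "closure A = UNIV"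
proof -
  have "negligible (- closure A)"
    using assms by (rule negligible_subset) (use closure_subset in auto)
  then have "- closure A = {}"
    using open_not_negligible[of "- closure A"] by auto
  then show ?thesis by blast
qed

lemma AE_lborel_iff_negligible: "(AE x in lborel. P x) \<longleftrightarrow> negligible {x. \<not> P x}"
  using AE_lebesgue_on_iff_negligible[of UNIV P]
  unfolding lebesgue_on_UNIV_eq AE_completion_iff by simp

text \<open>
  By Fubini's theorem a jointly Lebesgue measurable function has measurable time sections only at
  almost every state. These states are dense, and continuity in the state carries measurability over
  to the limit.
\<close>

lemma caratheodory_sections_measurable:
  fixes B :: "real \<Rightarrow> 'a::euclidean_space \<Rightarrow> 'b::euclidean_space"
  assumes meas: "(\<lambda>(t, x). B t x) \<in> borel_measurable (lebesgue_on ({a<..<b} \<times> UNIV))"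
    and cont: "\<And>t. t \<in> {a<..<b} \<Longrightarrow> continuous_on UNIV (B t)"
  shows "(\<lambda>t. B t p) \<in> borel_measurable (time_measure a b)"
proof (rule borel_measurable_euclidean_space[THEN iffD2], rule ballI)
  fix i :: 'b assume "i \<in> Basis"
  let ?S = "{a<..<b} \<times> (UNIV :: 'a set)"
  let ?g = "\<lambda>z. if z \<in> ?S then (case z of (t, x) \<Rightarrow> B t x \<bullet> i) else 0"
  have S: "?S \<in> sets lebesgue"
    using borel_open[OF open_Times[OF open_greaterThanLessThan open_UNIV]]
    by (intro sets_completionI_sets) (simp only: sets_lborel)
  have "(\<lambda>(t, x). B t x \<bullet> i) \<in> borel_measurable (lebesgue_on ?S)"
    using borel_measurable_inner[OF meas borel_measurable_const, of i] by (simp add: case_prod_beta')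
  then have "?g \<in> borel_measurable lebesgue"
    using S by (rule borel_measurable_if_I)
  then obtain g where g: "g \<in> borel_measurable lborel" and eq: "AE z in lborel. ?g z = g z"
    using completion_ex_borel_measurable_real by blast
  obtain N where N: "N \<in> null_sets lborel" "{z. ?g z \<noteq> g z} \<subseteq> N"
    using eq by (auto simp: eventually_ae_filter)
  have "AE z in lborel \<Otimes>\<^sub>M lborel. z \<notin> N"
    unfolding lborel_prod using N(1) by (rule AE_not_in)
  from lborel_pair.AE_pair[OF this] have "AE t in lborel. AE x in lborel. (t, x) \<notin> N" .
  moreover have "{z \<in> space (lborel \<Otimes>\<^sub>M lborel). (fst z, snd z) \<notin> N} \<in> sets (lborel \<Otimes>\<^sub>M (lborel :: 'a measure))"
    using N(1) unfolding lborel_prod by (auto simp: Compl_eq[symmetric])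
  ultimately have "AE x in lborel. AE t in lborel. (t, x) \<notin> N"
    using lborel_pair.AE_commute[of "\<lambda>t x. (t, x) \<notin> N"] by blast
  then have ae: "AE x in lborel. AE t in lborel. ?g (t, x) = g (t, x)"
  proof eventually_elim
    fix x assume "AE t in lborel. (t, x) \<notin> N"
    then show "AE t in lborel. ?g (t, x) = g (t, x)"
      by (rule eventually_mono) (use N(2) in blast)
  qed
  define A where "A = {x. (\<lambda>t. B t x \<bullet> i) \<in> borel_measurable (time_measure a b)}"
  have "x \<in> A" if x: "AE t in lborel. ?g (t, x) = g (t, x)" for x
  proof -
    have "(\<lambda>t. g (t, x)) \<in> borel_measurable lborel"
      using g by (intro measurable_compose[OF _ g]) (simp add: lborel_prod[symmetric])
    then have sect: "(\<lambda>t. g (t, x)) \<in> borel_measurable (time_measure a b)"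
      by (intro measurable_restrict_space1 measurable_completion)
    have "negligible {t. ?g (t, x) \<noteq> g (t, x)}"
      using x by (simp only: AE_lborel_iff_negligible)
    then show ?thesis
      unfolding A_def mem_Collect_eq
      by (intro borel_measurable_lebesgue_on_spike[OF sect]) auto
  qed
  then have "- A \<subseteq> {x. \<not> (AE t in lborel. ?g (t, x) = g (t, x))}" by blast
  with ae have "negligible (- A)"
    unfolding AE_lborel_iff_negligible[of "\<lambda>x. AE t in lborel. ?g (t, x) = g (t, x)"]
    by (rule negligible_subset)
  then have "p \<in> closure A" by (simp add: negligible_Compl_imp_dense)
  then obtain x where x: "\<And>n. x n \<in> A" "x \<longlonglongrightarrow> p"
    unfolding closure_sequential by blast
  show "(\<lambda>t. B t p \<bullet> i) \<in> borel_measurable (time_measure a b)"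
  proof (rule borel_measurable_LIMSEQ_metric)
    show "(\<lambda>t. B t (x n) \<bullet> i) \<in> borel_measurable (time_measure a b)" for n
      using x(1) by (simp add: A_def)
    fix t assume "t \<in> space (time_measure a b)"
    then show "(\<lambda>n. B t (x n) \<bullet> i) \<longlonglongrightarrow> B t p \<bullet> i"
      using x(2) by (intro tendsto_inner tendsto_const continuous_on_tendsto_compose[OF cont]) auto
  qed
qed

text \<open>
  Fubini's theorem gives the bound at almost every time for almost every state, and continuity
  for every state, so that it can be used along a trajectory, whose graph is a null set in space-time.
\<close>

lemma caratheodory_sections_bounded:
  fixes B :: "real \<Rightarrow> 'a::euclidean_space \<Rightarrow> 'b::euclidean_space"
  assumes bnd: "AE z in lebesgue_on ({a<..<b} \<times> UNIV). norm (case z of (t, x) \<Rightarrow> B t x) \<le> C"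
    and cont: "\<And>t. t \<in> {a<..<b} \<Longrightarrow> continuous_on UNIV (B t)"
  shows "AE t in time_measure a b. \<forall>x. norm (B t x) \<le> C"
proof -
  let ?S = "{a<..<b} \<times> (UNIV :: 'a set)"
  have S: "?S \<in> sets lebesgue"
    using borel_open[OF open_Times[OF open_greaterThanLessThan open_UNIV]]
    by (intro sets_completionI_sets) (simp only: sets_lborel)
  have "AE z in lborel. z \<in> ?S \<longrightarrow> norm (case z of (t, x) \<Rightarrow> B t x) \<le> C"
  proof -
    have "?S \<inter> space lebesgue \<in> sets lebesgue" using S by simp
    from bnd[unfolded AE_restrict_space_iff[OF this]] show ?thesis
      by (simp only: AE_completion_iff)
  qed
  then have "AE t in lborel. AE x in lborel. t \<in> {a<..<b} \<longrightarrow> norm (B t x) \<le> C"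
    using lborel_pair.AE_pair[of "\<lambda>z. z \<in> ?S \<longrightarrow> norm (case z of (t, x) \<Rightarrow> B t x) \<le> C"] unfolding lborel_prod by simp
  then have "AE t in lborel. t \<in> {a<..<b} \<longrightarrow> (\<forall>x. norm (B t x) \<le> C)"
  proof eventually_elim
    fix t assume ae: "AE x in lborel. t \<in> {a<..<b} \<longrightarrow> norm (B t x) \<le> C"
    show "t \<in> {a<..<b} \<longrightarrow> (\<forall>x. norm (B t x) \<le> C)"
    proof
      assume t: "t \<in> {a<..<b}"
      let ?A = "{x. norm (B t x) \<le> C}"
      have "negligible (- ?A)"
        using ae t by (simp add: AE_lborel_iff_negligible Compl_eq)
      then have "closure ?A = UNIV" by (rule negligible_Compl_imp_dense)
      moreover have "closed ?A"
        by (intro closed_Collect_le continuous_intros cont[OF t])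
      ultimately show "\<forall>x. norm (B t x) \<le> C" by (metis UNIV_I closure_closed mem_Collect_eq)
    qed
  qed
  then have "AE t in lebesgue. t \<in> {a<..<b} \<longrightarrow> (\<forall>x. norm (B t x) \<le> C)"
    by (simp only: AE_completion_iff)
  then show ?thesis
    by (subst AE_restrict_space_iff) auto
qed

section \<open>The control system\<close>

text \<open>
  Unlike the assumption of joint essential boundedness, the bound on \<open>B\<close> holds here at every state
  for almost every time, as its values along trajectories are needed.
\<close>

locale control_system = smooth_field_vec a b N L M E Df L2
  for a b :: real and N :: "real \<Rightarrow> real^'d \<Rightarrow> real^'d" and L M E Df L2 +
  fixes B :: "real \<Rightarrow> real^'d \<Rightarrow> real^'k^'d" and LB CB :: real and EB :: "real set"
  assumes LB: "LB \<ge> 0" and CB: "CB \<ge> 0" and EB: "negligible EB"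
    and B_meas: "\<And>p. (\<lambda>t. B t p) \<in> borel_measurable (time_measure a b)"
    and B_cont: "\<And>t. t \<in> {a<..<b} \<Longrightarrow> continuous_on UNIV (B t)"
    and B_lip: "\<And>t p q w. t \<in> {a<..<b} \<Longrightarrow> norm (B t p *v w - B t q *v w) \<le> LB * norm w * norm (p - q)"
    and B_bnd: "\<And>t p. t \<in> {a<..<b} - EB \<Longrightarrow> norm (B t p) \<le> CB"
begin

text \<open>
  The controlled equation is a Caratheodory equation whose Lipschitz constant depends on the
  essential bound of the control.
\<close>

lemma continuous_on_trajectory:
  assumes u: "u \<in> Linfty (time_measure a b)"
  shows "continuous_on {a..b} (trajectory a b N B x0 u)"
proof -
  have um: "u \<in> borel_measurable (time_measure a b)" using u by (simp add: Linfty_def)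
  obtain C where "AE t in time_measure a b. norm (u t) \<le> C"
    using u unfolding Linfty_def by blast
  then have Eu: "negligible {t \<in> {a<..<b}. \<not> norm (u t) \<le> C}" (is "negligible ?Eu")
    by (simp add: AE_lebesgue_on_iff_negligible)
  define U where "U = max C 0"
  have U: "U \<ge> 0" "norm (u t) \<le> U" if "t \<in> {a<..<b} - ?Eu" for t
    using that by (auto simp: U_def)
  have "U \<ge> 0" by (simp add: U_def)
  obtain K where K: "\<And>(A :: real^'k^'d) v. norm (A *v v) \<le> norm A * norm v * K" "K > 0"
    using bounded_bilinear.pos_bounded[OF bounded_bilinear_matrix_vector_mult] by blast
  interpret X: caratheodory_field a b "\<lambda>t x. N t x + B t x *v u t" "L + LB * U" "M + CB * U * K" "E \<union> EB \<union> ?Eu"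
  proof
    show "negligible (E \<union> EB \<union> ?Eu)" using E EB Eu by (intro negligible_Un)
    show "(\<lambda>t. N t p + B t p *v u t) \<in> borel_measurable (time_measure a b)" for p
      by (intro borel_measurable_add meas borel_measurable_bilinear[OF bounded_bilinear_matrix_vector_mult] B_meas um)
    show "norm (N t p + B t p *v u t - (N t q + B t q *v u t)) \<le> (L + LB * U) * norm (p - q)"
      if t: "t \<in> {a<..<b} - (E \<union> EB \<union> ?Eu)" for t p q
    proof -
      have "norm (N t p + B t p *v u t - (N t q + B t q *v u t))
          = norm ((N t p - N t q) + (B t p *v u t - B t q *v u t))" by (simp add: algebra_simps)
      also have "\<dots> \<le> L * norm (p - q) + LB * norm (u t) * norm (p - q)"
        using t by (intro norm_triangle_mono lip B_lip) auto
      also have "\<dots> \<le> L * norm (p - q) + LB * U * norm (p - q)"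
        using U t LB by (intro add_left_mono mult_right_mono mult_left_mono) auto
      finally show ?thesis by (simp add: algebra_simps)
    qed
    show "norm (N t 0 + B t 0 *v u t) \<le> M + CB * U * K" if t: "t \<in> {a<..<b} - (E \<union> EB \<union> ?Eu)" for t
    proof (rule norm_triangle_mono)
      show "norm (N t 0) \<le> M" using t by (intro bnd) auto
      have "norm (B t 0 *v u t) \<le> norm (B t 0) * norm (u t) * K" by (rule K(1))
      also have "\<dots> \<le> CB * U * K"
        using t U B_bnd[of t 0] K CB by (intro mult_right_mono mult_mono) auto
      finally show "norm (B t 0 *v u t) \<le> CB * U * K" .
    qed
  qed (use ab L LB M CB K \<open>U \<ge> 0\<close> in auto)
  have "a \<in> {a..b}" using ab by simp
  from X.ode_solution(1)[OF this, of x0] show ?thesis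
    unfolding X.integral_solution_def trajectory_def by (rule conjunct1)
qed

text \<open>
  The kernel through which a control acts at time \<open>t\<close> on the state transported to time \<open>\<tau>\<close>.
\<close>

definition transfer :: "real \<Rightarrow> real^'d \<Rightarrow> (real \<Rightarrow> real^'k) \<Rightarrow> real \<Rightarrow> real^'k^'d" where
  "transfer \<tau> x0 u t = D_flow a b N t \<tau> (trajectory a b N B x0 u t) ** B t (trajectory a b N B x0 u t)"

lemma gramian_eq_transfer:
  "gramian a b N B \<tau> x0 u = (\<integral>t. transfer \<tau> x0 u t ** transpose (transfer \<tau> x0 u t) \<partial>time_measure a b)"
  unfolding gramian_def transfer_def Let_def by (simp add: matrix_transpose_mul matrix_mul_assoc)

lemma synthesis_eq_transfer:
  "synthesis a b N B \<tau> x0 y u t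
     = transpose (transfer \<tau> x0 u t) *v (mp_inverse (gramian a b N B \<tau> x0 u) *v y)"
  by (simp only: synthesis_def transfer_def Let_def matrix_transpose_mul matrix_vector_mul_assoc matrix_mul_assoc)

lemma transfer_measurable:
  assumes "u \<in> Linfty (time_measure a b)" "\<tau> \<in> {a..b}"
  shows "transfer \<tau> x0 u \<in> borel_measurable (time_measure a b)"
proof -
  note x = continuous_on_trajectory[OF assms(1), of x0]
  have "(\<lambda>t. B t (trajectory a b N B x0 u t)) \<in> borel_measurable (time_measure a b)"
    using B_cont by (intro measurable_superposition[OF B_meas negligible_empty _ x]) auto
  then show ?thesis
    unfolding transfer_def[abs_def]
    by (rule borel_measurable_bilinear[OF bounded_bilinear_matrix_mult measurable_D_flow[OF x assms(2)]])
qed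

lemma transfer_bounded:
  assumes "\<tau> \<in> {a..b}"
  obtains C where "AE t in time_measure a b. norm (transfer \<tau> x0 u t) \<le> C"
proof -
  obtain K where K: "\<And>(P :: real^'d^'d) (Q :: real^'k^'d). norm (P ** Q) \<le> norm P * norm Q * K" "K > 0"
    using bounded_bilinear.pos_bounded[OF bounded_bilinear_matrix_mult] by blast
  define R where "R = CARD('d) * (CARD('d) * exp (L * (b - a)))"
  have "R \<ge> 0" by (simp add: R_def)
  have R: "norm (D_flow a b N t \<tau> p) \<le> R" if "t \<in> {a<..<b}" for t p
    unfolding R_def using that assms by (intro norm_matrix_le D_flow_bounds(2)) auto
  have "norm (transfer \<tau> x0 u t) \<le> R * CB * K" if t: "t \<in> {a<..<b} - EB" for t
    unfolding transfer_def
    using R B_bnd[OF t] t K(2) \<open>R \<ge> 0\<close> by (intro order_trans[OF K(1)] mult_right_mono mult_mono) auto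
  then have "AE t in time_measure a b. norm (transfer \<tau> x0 u t) \<le> R * CB * K"
    by (simp add: AE_lebesgue_on_iff_negligible) (rule negligible_subset[OF EB], auto)
  then show thesis by (rule that)
qed

lemma transfer_expansion:
  assumes "\<tau> \<in> {a..b}" and t: "t \<in> {a<..<b}"
    and \<beta>: "\<And>x y. \<beta> * norm y \<le> norm (transpose (B t x) *v y)" "\<beta> \<ge> 0"
  shows "exp (- L * (b - a)) * \<beta> * norm y \<le> norm (transpose (transfer \<tau> x0 u t) *v y)"
proof -
  let ?x = "trajectory a b N B x0 u t"
  have "exp (- L * (b - a)) * norm y \<le> norm (transpose (D_flow a b N t \<tau> ?x) *v y)"
    using assms by (intro transpose_expansion D_flow_bounds(1)) auto
  then have "\<beta> * (exp (- L * (b - a)) * norm y) \<le> \<beta> * norm (transpose (D_flow a b N t \<tau> ?x) *v y)"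
    using \<beta>(2) by (rule mult_left_mono)
  also have "\<dots> \<le> norm (transpose (B t ?x) *v (transpose (D_flow a b N t \<tau> ?x) *v y))"
    by (rule \<beta>(1))
  also have "\<dots> = norm (transpose (transfer \<tau> x0 u t) *v y)"
    by (simp only: transfer_def matrix_transpose_mul matrix_vector_mul_assoc)
  finally show ?thesis by (simp only: mult.commute mult.left_commute)
qed

lemma gramian_symmetric:
  assumes "u \<in> Linfty (time_measure a b)" "\<tau> \<in> {a..b}"
  shows "transpose (gramian a b N B \<tau> x0 u) = gramian a b N B \<tau> x0 u"
proof -
  interpret finite_measure "time_measure a b" by (rule finite_measure_lebesgue_on) simp
  obtain C where "AE t in time_measure a b. norm (transfer \<tau> x0 u t) \<le> C"
    using transfer_bounded[OF assms(2)] .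
  then show ?thesis
    unfolding gramian_eq_transfer by (rule gram_symmetric[OF transfer_measurable[OF assms]])
qed

lemma gramian_coercive:
  assumes u: "u \<in> Linfty (time_measure a b)" and \<tau>: "\<tau> \<in> {a..b}"
    and \<beta>: "integrable (time_measure a b) \<beta>" "AE t in time_measure a b. \<beta> t \<ge> 0"
    and lower: "AE t in time_measure a b. \<forall>x y. norm (transpose (B t x) *v y) \<ge> \<beta> t * norm y"
  shows "exp (- 2 * L * (b - a)) * (L1_norm (time_measure a b) \<beta>)\<^sup>2 / (b - a) * (norm y)\<^sup>2
    \<le> y \<bullet> (gramian a b N B \<tau> x0 u *v y)"
proof -
  interpret finite_measure "time_measure a b" by (rule finite_measure_lebesgue_on) simp
  let ?c = "exp (- L * (b - a))"
  obtain C where C: "AE t in time_measure a b. norm (transfer \<tau> x0 u t) \<le> C"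
    using transfer_bounded[OF \<tau>] .
  have \<mu>: "measure (time_measure a b) (space (time_measure a b)) = b - a"
    using ab by (simp add: measure_restrict_space)
  have L1: "L1_norm (time_measure a b) \<beta> = (\<integral>t. \<beta> t \<partial>time_measure a b)"
    unfolding L1_norm_def using \<beta> by (intro integral_cong_AE) (auto elim: eventually_mono)
  have "(\<integral>t. ?c * \<beta> t \<partial>time_measure a b)\<^sup>2 / measure (time_measure a b) (space (time_measure a b)) * (norm y)\<^sup>2
      \<le> y \<bullet> ((\<integral>t. transfer \<tau> x0 u t ** transpose (transfer \<tau> x0 u t) \<partial>time_measure a b) *v y)"
  proof (rule gram_coercive[OF transfer_measurable[OF u \<tau>] C])
    have "AE t in time_measure a b. t \<in> {a<..<b}"
      using AE_space[of "time_measure a b"] by simp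
    with lower \<beta>(2) show "AE t in time_measure a b. \<forall>y. ?c * \<beta> t * norm y \<le> norm (transpose (transfer \<tau> x0 u t) *v y)"
      by eventually_elim (intro allI transfer_expansion[OF \<tau>], auto)
    show "integrable (time_measure a b) (\<lambda>t. ?c * \<beta> t)" using \<beta> by simp
    show "AE t in time_measure a b. 0 \<le> ?c * \<beta> t" using \<beta>(2) by eventually_elim simp
  qed (unfold \<mu>, use ab in simp)
  moreover have "?c\<^sup>2 = exp (- 2 * L * (b - a))"
    by (simp add: power2_eq_square exp_add[symmetric])
  ultimately show ?thesis
    unfolding \<mu> by (simp add: gramian_eq_transfer L1 power_mult_distrib)
qed

lemma synthesis_Linfty:
  assumes u: "u \<in> Linfty (time_measure a b)" and \<tau>: "\<tau> \<in> {a..b}"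
  shows "synthesis a b N B \<tau> x0 y u \<in> Linfty (time_measure a b)"
proof -
  define z where "z = mp_inverse (gramian a b N B \<tau> x0 u) *v y"
  let ?W = "transfer \<tau> x0 u"
  obtain C where C: "AE t in time_measure a b. norm (?W t) \<le> C"
    using transfer_bounded[OF \<tau>] .
  have "bounded_linear (\<lambda>W :: real^'k^'d. transpose W *v z)"
    by (intro bounded_linear_compose[OF bounded_bilinear.bounded_linear_left[OF bounded_bilinear_matrix_vector_mult]]
        bounded_linear_transpose)
  then obtain K where K: "\<And>W :: real^'k^'d. norm (transpose W *v z) \<le> norm W * K" "K > 0"
    and cont: "continuous_on UNIV (\<lambda>W :: real^'k^'d. transpose W *v z)"
    using bounded_linear.pos_bounded linear_continuous_on by blast
  have "(\<lambda>t. transpose (?W t) *v z) \<in> borel_measurable (time_measure a b)"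
    by (rule borel_measurable_continuous_on[OF cont transfer_measurable[OF u \<tau>]])
  moreover have "AE t in time_measure a b. norm (transpose (?W t) *v z) \<le> C * K"
    using C
  proof eventually_elim
    fix t assume "norm (?W t) \<le> C"
    then show "norm (transpose (?W t) *v z) \<le> C * K"
      using K(2) by (intro order_trans[OF K(1)] mult_right_mono) auto
  qed
  moreover have "synthesis a b N B \<tau> x0 y u = (\<lambda>t. transpose (?W t) *v z)"
    by (rule ext) (simp only: synthesis_eq_transfer z_def)
  ultimately show ?thesis unfolding Linfty_def by auto
qed

end

lemma admissible_control_system:
  fixes N :: "real \<Rightarrow> real^'d \<Rightarrow> real^'d" and B :: "real \<Rightarrow> real^'d \<Rightarrow> real^'k^'d"
  assumes "t0 < T" "\<Lambda>1 > 0" "\<Lambda>2 > 0" "LB \<ge> 0"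
    and N: "admissible_drift t0 T N \<Lambda>1 \<Lambda>2" and B: "admissible_control_operator t0 T B LB"
  obtains M E Df CB EB where "control_system t0 T N \<Lambda>1 M E Df \<Lambda>2 B LB CB EB"
proof -
  obtain M E Df where "smooth_field_vec t0 T N \<Lambda>1 M E Df \<Lambda>2"
    using admissible_drift_smooth_field[OF assms(1-3) N] .
  then interpret smooth_field_vec t0 T N \<Lambda>1 M E Df \<Lambda>2 .
  obtain DB :: "real \<Rightarrow> real^'d \<Rightarrow> ((real^'d) \<Rightarrow>\<^sub>L (real^'k^'d))"
    where DB: "\<And>t x. t \<in> {t0<..<T} \<Longrightarrow> (B t has_derivative blinfun_apply (DB t x)) (at x)"
      and DB_le: "\<And>t x v. t \<in> {t0<..<T} \<Longrightarrow> spectral_norm (blinfun_apply (DB t x) v) \<le> LB * norm v"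
  proof -
    from B obtain DB where "\<forall>t\<in>{t0<..<T}. continuous_on UNIV (DB t) \<and>
         (\<forall>x. (B t has_derivative blinfun_apply (DB t x)) (at x) \<and>
              (\<forall>v. spectral_norm (blinfun_apply (DB t x) v) \<le> LB * norm v))"
      unfolding admissible_control_operator_def by (elim conjE exE)
    then show thesis by (intro that[of DB]) simp_all
  qed
  have cont: "continuous_on UNIV (B t)" if "t \<in> {t0<..<T}" for t
    using DB[OF that] by (intro has_derivative_continuous_on) (auto intro: has_derivative_at_withinI)
  have meas: "(\<lambda>(t, x). B t x) \<in> borel_measurable (lebesgue_on ({t0<..<T} \<times> UNIV))"
    using B by (simp add: admissible_control_operator_def Linfty_def)
  obtain C where "AE z in lebesgue_on ({t0<..<T} \<times> UNIV). norm (case z of (t, x) \<Rightarrow> B t x) \<le> C"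
    using B unfolding admissible_control_operator_def Linfty_def by blast
  then have "AE t in time_measure t0 T. \<forall>x. norm (B t x) \<le> C"
    by (rule caratheodory_sections_bounded[OF _ cont])
  then have EB: "negligible {t \<in> {t0<..<T}. \<not> (\<forall>x. norm (B t x) \<le> C)}" (is "negligible ?EB")
    by (simp add: AE_lebesgue_on_iff_negligible)
  have "control_system t0 T N \<Lambda>1 M E Df \<Lambda>2 B LB (max C 0) ?EB"
  proof
    show "(\<lambda>t. B t p) \<in> borel_measurable (time_measure t0 T)" for p
      by (rule caratheodory_sections_measurable[OF meas cont])
    show "norm (B t p *v w - B t q *v w) \<le> LB * norm w * norm (p - q)" if t: "t \<in> {t0<..<T}" for t p q w
    proof (rule differentiable_bound[of UNIV "\<lambda>x. B t x *v w" "\<lambda>x v. blinfun_apply (DB t x) v *v w"])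
      show "((\<lambda>x. B t x *v w) has_derivative (\<lambda>v. blinfun_apply (DB t x) v *v w)) (at x within UNIV)" for x
        using DB[OF t, of x]
        by (intro bounded_linear.has_derivative[OF bounded_bilinear.bounded_linear_left[OF bounded_bilinear_matrix_vector_mult]])
      show "onorm (\<lambda>v. blinfun_apply (DB t x) v *v w) \<le> LB * norm w" for x
      proof (rule onorm_bound)
        fix v
        have "norm (blinfun_apply (DB t x) v *v w) \<le> spectral_norm (blinfun_apply (DB t x) v) * norm w"
          unfolding spectral_norm_def by (rule onorm) (rule matrix_vector_mul_bounded_linear)
        also have "\<dots> \<le> LB * norm v * norm w"
          by (intro mult_right_mono DB_le t) simp
        finally show "norm (blinfun_apply (DB t x) v *v w) \<le> LB * norm w * norm v"
          by (simp only: mult.commute mult.left_commute)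
      qed (use \<open>LB \<ge> 0\<close> in simp)
    qed auto
    show "norm (B t p) \<le> max C 0" if "t \<in> {t0<..<T} - ?EB" for t p
      using that by (auto simp: le_max_iff_disj)
  qed (use EB \<open>LB \<ge> 0\<close> cont in auto)
  then show thesis by (rule that)
qed

theorem proposition3p19:
  fixes t0 T \<Lambda>1 \<Lambda>2 LB :: real
    and N :: "real \<Rightarrow> real^'d \<Rightarrow> real^'d"
    and B :: "real \<Rightarrow> real^'d \<Rightarrow> real^'k^'d"
    and b :: "real \<Rightarrow> real"
    and i :: nat
  assumes "t0 < T"
    and "\<Lambda>1 > 0" and "\<Lambda>2 > 0" and "LB \<ge> 0"
    and "admissible_drift t0 T N \<Lambda>1 \<Lambda>2"
    and "admissible_control_operator t0 T B LB"
    and "i \<in> {1, 2}"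
    and "CARD('d) = CARD('k)"
    and "integrable (time_measure t0 T) b"
    and "AE t in time_measure t0 T. b t \<ge> 0"
    and "\<not> (AE t in time_measure t0 T. b t = 0)"
    and "AE t in time_measure t0 T. \<forall>(x :: real^'d) (y :: real^'d).
           norm (transpose (B t x) *v y) \<ge> b t * norm y"
  shows "(\<forall>(y :: real^'d) x0. \<forall>u \<in> Linfty (time_measure t0 T).
            y \<bullet> (gramian t0 T N B (tau t0 T i) x0 u *v y)
              \<ge> exp (- 2 * \<Lambda>1 * (T - t0)) * (L1_norm (time_measure t0 T) b)\<^sup>2 / (T - t0)
                 * (norm y)\<^sup>2) \<and>
         (let C = (T - t0) * exp (2 * \<Lambda>1 * (T - t0)) / (L1_norm (time_measure t0 T) b)\<^sup>2 in
            \<forall>x0.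
              coercive_controls t0 T N B (tau t0 T i) x0 C = Linfty (time_measure t0 T) \<and>
              (\<forall>y. synthesis t0 T N B (tau t0 T i) x0 y
                       ` coercive_controls t0 T N B (tau t0 T i) x0 C
                     \<subseteq> coercive_controls t0 T N B (tau t0 T i) x0 C))"
proof -
  obtain M E Df CB EB where "control_system t0 T N \<Lambda>1 M E Df \<Lambda>2 B LB CB EB"
    using admissible_control_system[OF assms(1-6)] .
  then interpret control_system t0 T N \<Lambda>1 M E Df \<Lambda>2 B LB CB EB .
  let ?\<tau> = "tau t0 T i"
  let ?c = "exp (- 2 * \<Lambda>1 * (T - t0)) * (L1_norm (time_measure t0 T) b)\<^sup>2 / (T - t0)"
  define C where "C = (T - t0) * exp (2 * \<Lambda>1 * (T - t0)) / (L1_norm (time_measure t0 T) b)\<^sup>2"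
  have \<tau>: "?\<tau> \<in> {t0..T}" using \<open>t0 < T\<close> by (simp add: tau_def)
  have inv_C: "inverse C = ?c"
    by (simp add: C_def exp_minus divide_inverse)
  have coercive: "?c * (norm y)\<^sup>2 \<le> y \<bullet> (gramian t0 T N B ?\<tau> x0 u *v y)"
    if "u \<in> Linfty (time_measure t0 T)" for y x0 u
    by (rule gramian_coercive[OF that \<tau> assms(9,10,12)])
  have eq: "coercive_controls t0 T N B ?\<tau> x0 C = Linfty (time_measure t0 T)" for x0
    unfolding coercive_controls_def inv_C
    using lambda_min_ge[OF gramian_symmetric[OF _ \<tau>] coercive] by blast
  show ?thesis
    unfolding C_def[symmetric] Let_def eq
    using coercive synthesis_Linfty[OF _ \<tau>] by blast
qed

end
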